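(* Let $b$, $\mu_0$, $(\Omega,\mathscr{F})$, $(\mathsf{P}_t)_{t\ge0}$, the random elements $\nu$, $(\tau_n)$, $(\phi_n)$, $(\vartheta_n)$, $(\mathbf{X}_j)$, the arrays $(\pi_{1,n},\dots,\pi_{n,n})$ and $(\mathrm{O}_{1,n},\dots,\mathrm{O}_{n,n})$, the vectors $\psi_{j,n}(u)$ and the random probability measure $\mathcal{M}$ be as in the context (so that, for every $t\ge0$ and Borel $D$, $\mu(D,t)=\mathsf{E}_t[\mathcal{M}(D)]$, $\mu$ being the measure solution of the Boltzmann equation with initial datum $\mu_0$). Then one can construct two $\sigma$-algebras $\mathscr{G}$ and $\mathscr{H}$ on $\Omega$ such that: (i) $\mathscr{G}\subsetneq\mathscr{H}\subsetneq\mathscr{F}$; (ii) $\mathcal{M}$, $\nu$ and the arrays $(\pi_{1,n},\dots,\pi_{n,n})$ are $\mathscr{G}$-measurable for every $n$; (iii) the arrays $(\mathrm{O}_{1,n},\dots,\mathrm{O}_{n,n})$ are $\mathscr{H}$-measurable for every $n$ but not $\mathscr{G}$-measurable for $n\ge 2$; (iv) the sequence $(\mathbf{X}_j)_{j\ge1}$ is independent of $\mathscr{H}$ (under every $\mathsf{P}_t$); (v) for $u\in S^2$ and $S(u):=\sum_{j=1}^{\nu}\pi_{j,\nu}\,\psi_{j,\nu}(u)\cdot\mathbf{X}_j$, there is a version of $\mathsf{E}_t[e^{i\rho S(u)}\mid\mathscr{H}]$ which, as a function of $\rho\in\mathbb{R}$, is the characteristic function of a (finite) sum of independent random numbers; (vi)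 for every fixed $\xi\in\mathbb{R}^3\setminus\{0\}$, with $\rho:=|\xi|$ and $u:=\xi/|\xi|$, $\hat{\mathcal{M}}(\xi)=\mathsf{E}_t[e^{i\rho S(u)}\mid\mathscr{G}]=\mathsf{E}_t\big[\mathsf{E}_t[e^{i\rho S(u)}\mid\mathscr{H}]\mid\mathscr{G}\big].$ Finally, the terms in (vi) do not depend on the choice of the matrices $\mathrm{B}(u)$.
   Context: Standing assumptions: $b:(-1,1)\to[0,\infty)$ is measurable, $b(x)=b(\sqrt{1-x^2})\frac{|x|}{\sqrt{1-x^2}}=b(-x)$ on $(-1,1)$, and $\int_0^1 b=1$; $\mu_0$ is a probability measure on $\mathscr{B}(\mathbb{R}^3)$. The Fourier transform of a probability measure $\zeta$ on $\mathbb{R}^3$ is $\hat\zeta(\xi)=\int e^{i\xi\cdot x}\zeta(dx)$. Let $\beta(d\varphi)=\frac12 b(\cos\varphi)\sin\varphi\,d\varphi$ (a probability measure on $[0,\pi]$) and $u_{(0,2\pi)}$ the uniform distribution on $(0,2\pi)$. Trees: $\mathbb{T}(1)=\{\mathfrak{t}_1\}$ (a single leaf) and, for $n\ge2$, $\mathbb{T}(n)=\bigcup_{k=1}^{n-1}\mathbb{T}(k)\times\mathbb{T}(n-k)$; a tree $\mathfrak{t}_n=(\mathfrak{t}_n^l,\mathfrak{t}_n^r)\in\mathbb{T}(n)$ has left subtree $\mathfrak{t}_n^l$ with $n_l$ leaves and right subtree $\mathfrak{t}_n^r$ with $n_r=n-n_l$ leaves; leaves are numbered left to right (leaves $1,\dots,n_l$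 are those of $\mathfrak{t}^l_n$). The germination $\mathfrak{t}_{n,k}$ ($1\le k\le n$) is the tree in $\mathbb{T}(n+1)$ obtained by replacing the $k$-th leaf by the two-leaved tree $\mathfrak{t}_2=(\mathfrak{t}_1,\mathfrak{t}_1)$. For $\boldsymbol\varphi=(\varphi_1,\dots,\varphi_{n-1})$ write $\boldsymbol\varphi^l=(\varphi_1,\dots,\varphi_{n_l-1})$, $\boldsymbol\varphi^r=(\varphi_{n_l},\dots,\varphi_{n-2})$ (empty if $n_l=1$, resp. $n_r=1$), and similarly $\boldsymbol\theta^l,\boldsymbol\theta^r$. Probability space: $\Omega=\mathbb{N}\times\mathbb{T}\times[0,\pi]^\infty\times(0,2\pi)^\infty\times(\mathbb{R}^3)^\infty$ with $\mathbb{T}=\prod_{n\ge1}\mathbb{T}(n)$, $\mathscr{F}$ the product Borel $\sigma$-algebra (discrete topologies on $\mathbb{N}$, $\mathbb{T}(n)$), and coordinates $\nu,(\tau_n)_{n\ge1},(\phi_n)_{n\ge1},(\vartheta_n)_{n\ge1},(\mathbf{X}_n)_{n\ge1}$. For $t\ge0$, $\mathsf{P}_t$ makes $\nu$, $(\tau_n)$, $(\phi_n)$, $(\vartheta_n)$, $(\mathbf{X}_n)$ mutually independent with: $\mathsf{P}_t[\nu=n]=e^{-t}(1-e^{-t})^{n-1}$ ($0^0:=1$); $(\tau_n)$ Markov with $\tau_1=\mathfrak{t}_1$ and $\mathsf{P}_t[\tau_{n+1}=\mathfrak{t}_{n,k}\mid\tau_n=\mathfrak{t}_n]=1/n$ for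 $k=1,\dots,n$; $\phi_n$ i.i.d. with law $\beta$; $\vartheta_n$ i.i.d. uniform on $(0,2\pi)$; $\mathbf{X}_n$ i.i.d. with law $\mu_0$. Coefficients: $\pi^*_{1,1}\equiv1$; for $n\ge2$, $\pi^*_{j,n}(\mathfrak{t}_n,\boldsymbol\varphi)=\pi^*_{j,n_l}(\mathfrak{t}_n^l,\boldsymbol\varphi^l)\cos\varphi_{n-1}$ for $j\le n_l$ and $=\pi^*_{j-n_l,n-n_l}(\mathfrak{t}^r_n,\boldsymbol\varphi^r)\sin\varphi_{n-1}$ for $j>n_l$; $\pi_{j,n}:=\pi^*_{j,n}(\tau_n,(\phi_1,\dots,\phi_{n-1}))$. Matrices: $\mathrm{M}^l(\varphi,\theta)=\begin{pmatrix}-\cos\theta\cos\varphi&\sin\theta&\cos\theta\sin\varphi\\-\sin\theta\cos\varphi&-\cos\theta&\sin\theta\sin\varphi\\\sin\varphi&0&\cos\varphi\end{pmatrix}$, $\mathrm{M}^r(\varphi,\theta)=\begin{pmatrix}\sin\theta&\cos\theta\sin\varphi&-\cos\theta\cos\varphi\\-\cos\theta&\sin\theta\sin\varphi&-\sin\theta\cos\varphi\\0&\cos\varphi&\sin\varphi\end{pmatrix}$; $\mathrm{O}^*_{1,1}\equiv\mathrm{Id}$ and for $n\ge2$, $\mathrm{O}^*_{j,n}(\mathfrak{t}_n,\boldsymbol\varphi,\boldsymbol\theta)=\mathrm{M}^l(\varphi_{n-1},\theta_{n-1})\mathrm{O}^*_{j,n_l}(\mathfrak{t}^l_n,\boldsymbol\varphi^l,\boldsymbol\theta^l)$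 for $j\le n_l$ and $=\mathrm{M}^r(\varphi_{n-1},\theta_{n-1})\mathrm{O}^*_{j-n_l,n-n_l}(\mathfrak{t}^r_n,\boldsymbol\varphi^r,\boldsymbol\theta^r)$ for $j>n_l$; $\mathrm{O}_{j,n}:=\mathrm{O}^*_{j,n}(\tau_n,(\phi_1,\dots,\phi_{n-1}),(\vartheta_1,\dots,\vartheta_{n-1}))\in\mathbb{SO}(3)$. For each $u\in S^2$, $\mathrm{B}(u)\in\mathbb{SO}(3)$ is a chosen matrix with third column $u$, and $\psi_{j,n}(u):=\mathrm{B}(u)\mathrm{O}_{j,n}\mathbf{e}_3$ with $\mathbf{e}_3=(0,0,1)^t$. The random measure $\mathcal{M}$: for $u\in S^2$ choose $a(u),b(u)$ with $\{a(u),b(u),u\}$ a positive orthonormal basis and put $\psi^l(\varphi,\theta,u)=\cos\theta\sin\varphi\,a(u)+\sin\theta\sin\varphi\,b(u)+\cos\varphi\,u$, $\psi^r(\varphi,\theta,u)=-\cos\theta\cos\varphi\,a(u)-\sin\theta\cos\varphi\,b(u)+\sin\varphi\,u$. For probability measures $\zeta,\eta$ on $\mathbb{R}^3$ and $\varphi\in[0,\pi]$, $\mathcal{C}[\zeta,\eta;\varphi]$ is the probability measure on $\mathbb{R}^3$ whose Fourier transform equals $1$ at $\xi=0$ and, for $\xi\ne0$, $\rho=|\xi|$, $u=\xi/\rho$, equals $\int_0^{2\pi}\hat\zeta(\rho\cos\varphi\,\psi^l(\varphi,\theta,u))\,\hat\eta(\rho\sin\varphi\,\psi^r(\varphi,\theta,u))\,u_{(0,2\pi)}(d\theta)$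 (this is a characteristic function, independent of the choice of basis). Set $\mathcal{C}_{\mathfrak{t}_1}[\mu_0;\emptyset]=\mu_0$ and $\mathcal{C}_{\mathfrak{t}_n}[\mu_0;\boldsymbol\varphi]=\mathcal{C}[\mathcal{C}_{\mathfrak{t}^l_n}[\mu_0;\boldsymbol\varphi^l],\mathcal{C}_{\mathfrak{t}^r_n}[\mu_0;\boldsymbol\varphi^r];\varphi_{n-1}]$, and $\mathcal{M}:=\mathcal{C}_{\tau_\nu}[\mu_0;(\phi_1,\dots,\phi_{\nu-1})]$ (with $(\phi_1,\dots,\phi_{\nu-1})=\emptyset$ if $\nu=1$). Measure solutions of the Boltzmann equation are as in the standard weak formulation with collision kernel $b$ (existing and unique for every initial datum). *)

theory Defs
  imports "HOL-Probability.Probability"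
begin

datatype tree = Leaf | Node tree tree

fun leaves :: "tree \<Rightarrow> nat" where
  "leaves Leaf = 1"
| "leaves (Node l r) = leaves l + leaves r"

definition trees :: "nat \<Rightarrow> tree set" where
  "trees n = {t. leaves t = n}"

text \<open>Germination: replace the k-th leaf (counted from the left, starting at 1) by a cherry.\<close>
fun germ :: "tree \<Rightarrow> nat \<Rightarrow> tree" where
  "germ Leaf k = Node Leaf Leaf"
| "germ (Node l r) k =
     (if k \<le> leaves l then Node (germ l k) r else Node l (germ r (k - leaves l)))"

text \<open>Shift of an index vector (indexed from 1): the right-subtree part starts at index nl.\<close>
definition shiftv :: "nat \<Rightarrow> (nat \<Rightarrow> 'a) \<Rightarrow> nat \<Rightarrow> 'a" where
  "shiftv nl v = (\<lambda>i. v (i + nl - 1))"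

fun pistar :: "tree \<Rightarrow> (nat \<Rightarrow> real) \<Rightarrow> nat \<Rightarrow> real" where
  "pistar Leaf phi j = 1"
| "pistar (Node l r) phi j =
     (if j \<le> leaves l then pistar l phi j * cos (phi (leaves l + leaves r - 1))
      else pistar r (shiftv (leaves l) phi) (j - leaves l) * sin (phi (leaves l + leaves r - 1)))"

definition Ml :: "real \<Rightarrow> real \<Rightarrow> real^3^3" where
  "Ml phi th = vector [vector [- cos th * cos phi, sin th, cos th * sin phi],
                       vector [- sin th * cos phi, - cos th, sin th * sin phi],
                       vector [sin phi, 0, cos phi]]"

definition Mr :: "real \<Rightarrow> real \<Rightarrow> real^3^3" where
  "Mr phi th = vector [vector [sin th, cos th * sin phi, - cos th * cos phi],
                       vector [- cos th, sin th * sin phi, - sin th * cos phi],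
                       vector [0, cos phi, sin phi]]"

fun Ostar :: "tree \<Rightarrow> (nat \<Rightarrow> real) \<Rightarrow> (nat \<Rightarrow> real) \<Rightarrow> nat \<Rightarrow> real^3^3" where
  "Ostar Leaf phi th j = mat 1"
| "Ostar (Node l r) phi th j =
     (if j \<le> leaves l
      then Ml (phi (leaves l + leaves r - 1)) (th (leaves l + leaves r - 1)) ** Ostar l phi th j
      else Mr (phi (leaves l + leaves r - 1)) (th (leaves l + leaves r - 1)) **
             Ostar r (shiftv (leaves l) phi) (shiftv (leaves l) th) (j - leaves l))"

definition e3 :: "real^3" where "e3 = vector [0, 0, 1]"

definition ft :: "(real^3) measure \<Rightarrow> real^3 \<Rightarrow> complex" where
  "ft m xi = (CLINT x|m. iexp (xi \<bullet> x))"

definition posbasis :: "real^3 \<Rightarrow> real^3 \<Rightarrow> real^3 \<Rightarrow> bool" where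
  "posbasis a b u \<longleftrightarrow> a \<bullet> a = 1 \<and> b \<bullet> b = 1 \<and> u \<bullet> u = 1 \<and> a \<bullet> b = 0 \<and> a \<bullet> u = 0 \<and> b \<bullet> u = 0
     \<and> det (transpose (vector [a, b, u] :: real^3^3)) = 1"

definition frame_a :: "real^3 \<Rightarrow> real^3" where
  "frame_a u = fst (SOME p. posbasis (fst p) (snd p) u)"

definition frame_b :: "real^3 \<Rightarrow> real^3" where
  "frame_b u = snd (SOME p. posbasis (fst p) (snd p) u)"

definition psil :: "real \<Rightarrow> real \<Rightarrow> real^3 \<Rightarrow> real^3" where
  "psil phi th u = (cos th * sin phi) *\<^sub>R frame_a u + (sin th * sin phi) *\<^sub>R frame_b u + cos phi *\<^sub>R u"

definition psir :: "real \<Rightarrow> real \<Rightarrow> real^3 \<Rightarrow> real^3" where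
  "psir phi th u = (- cos th * cos phi) *\<^sub>R frame_a u + (- sin th * cos phi) *\<^sub>R frame_b u + sin phi *\<^sub>R u"

definition unif :: "real measure" where
  "unif = restrict_space (uniform_measure lborel {0<..<2*pi}) {0<..<2*pi}"

definition Cop :: "(real^3) measure \<Rightarrow> (real^3) measure \<Rightarrow> real \<Rightarrow> (real^3) measure" where
  "Cop zeta eta phi = (THE m. prob_space m \<and> sets m = sets borel \<and>
     (\<forall>xi. ft m xi = (if xi = 0 then 1 else
        (CLINT th|unif. ft zeta ((norm xi * cos phi) *\<^sub>R psil phi th (xi /\<^sub>R norm xi))
                      * ft eta ((norm xi * sin phi) *\<^sub>R psir phi th (xi /\<^sub>R norm xi))))))"

fun Ctree :: "tree \<Rightarrow> (real^3) measure \<Rightarrow> (nat \<Rightarrow> real) \<Rightarrow> (real^3) measure" where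
  "Ctree Leaf mu0 phi = mu0"
| "Ctree (Node l r) mu0 phi =
     Cop (Ctree l mu0 phi) (Ctree r mu0 (shiftv (leaves l) phi)) (phi (leaves l + leaves r - 1))"

type_synonym omega = "nat \<times> (nat \<Rightarrow> tree) \<times> (nat \<Rightarrow> real) \<times> (nat \<Rightarrow> real) \<times> (nat \<Rightarrow> real^3)"

definition TS :: "(nat \<Rightarrow> tree) measure" where
  "TS = PiM {1..} (\<lambda>n. count_space (trees n))"

definition Omega :: "omega measure" where
  "Omega = count_space {1..} \<Otimes>\<^sub>M (TS \<Otimes>\<^sub>M (PiM {1..} (\<lambda>_. restrict_space borel {0..pi})
     \<Otimes>\<^sub>M (PiM {1..} (\<lambda>_. restrict_space borel {0<..<2*pi}) \<Otimes>\<^sub>M PiM {1..} (\<lambda>_. borel))))"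

definition nu_law :: "real \<Rightarrow> nat measure" where
  "nu_law t = density (count_space {1..}) (\<lambda>n. ennreal (exp (- t) * (1 - exp (- t)) ^ (n - 1)))"

text \<open>The Markov law of the tree sequence, described through its finite-dimensional distributions.\<close>
definition tau_law :: "(nat \<Rightarrow> tree) measure \<Rightarrow> bool" where
  "tau_law T \<longleftrightarrow> prob_space T \<and> sets T = sets TS \<and>
     (\<forall>n\<ge>1. \<forall>s. (\<forall>m\<in>{1..n}. s m \<in> trees m) \<longrightarrow>
        emeasure T {f\<in>space TS. \<forall>m\<in>{1..n}. f m = s m}
        = ennreal (\<Prod>m\<in>{1..<n}. real (card {k\<in>{1..m}. germ (s m) k = s (Suc m)}) / real m))"

definition beta_law :: "(real \<Rightarrow> real) \<Rightarrow> real measure" where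
  "beta_law b = density (restrict_space lborel {0..pi}) (\<lambda>phi. ennreal (b (cos phi) * sin phi / 2))"

definition Pt :: "(real \<Rightarrow> real) \<Rightarrow> (real^3) measure \<Rightarrow> (nat \<Rightarrow> tree) measure \<Rightarrow> real \<Rightarrow> omega measure" where
  "Pt b mu0 T t = nu_law t \<Otimes>\<^sub>M (T \<Otimes>\<^sub>M (PiM {1..} (\<lambda>_. beta_law b)
     \<Otimes>\<^sub>M (PiM {1..} (\<lambda>_. unif) \<Otimes>\<^sub>M PiM {1..} (\<lambda>_. mu0))))"

definition nu :: "omega \<Rightarrow> nat" where "nu w = fst w"
definition tau :: "nat \<Rightarrow> omega \<Rightarrow> tree" where "tau n w = fst (snd w) n"
definition phis :: "omega \<Rightarrow> nat \<Rightarrow> real" where "phis w = fst (snd (snd w))"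
definition thetas :: "omega \<Rightarrow> nat \<Rightarrow> real" where "thetas w = fst (snd (snd (snd w)))"
definition Xs :: "omega \<Rightarrow> nat \<Rightarrow> real^3" where "Xs w = snd (snd (snd (snd w)))"

definition pi_rv :: "nat \<Rightarrow> nat \<Rightarrow> omega \<Rightarrow> real" where
  "pi_rv j n w = pistar (tau n w) (phis w) j"

definition O_rv :: "nat \<Rightarrow> nat \<Rightarrow> omega \<Rightarrow> real^3^3" where
  "O_rv j n w = Ostar (tau n w) (phis w) (thetas w) j"

definition psi_rv :: "(real^3 \<Rightarrow> real^3^3) \<Rightarrow> nat \<Rightarrow> nat \<Rightarrow> real^3 \<Rightarrow> omega \<Rightarrow> real^3" where
  "psi_rv B j n u w = B u *v (O_rv j n w *v e3)"

definition Mrand :: "(real^3) measure \<Rightarrow> omega \<Rightarrow> (real^3) measure" where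
  "Mrand mu0 w = Ctree (tau (nu w) w) mu0 (phis w)"

definition S_rv :: "(real^3 \<Rightarrow> real^3^3) \<Rightarrow> real^3 \<Rightarrow> omega \<Rightarrow> real" where
  "S_rv B u w = (\<Sum>j\<in>{1..nu w}. pi_rv j (nu w) w * (psi_rv B j (nu w) u w \<bullet> Xs w j))"

text \<open>Y is a version of E[Z | G] under M, where G is a sub-sigma-algebra (given as a measure on the same space).\<close>
definition is_cond_exp :: "'a measure \<Rightarrow> 'a measure \<Rightarrow> ('a \<Rightarrow> complex) \<Rightarrow> ('a \<Rightarrow> complex) \<Rightarrow> bool" where
  "is_cond_exp M G Z Y \<longleftrightarrow> Y \<in> borel_measurable G \<and> integrable M Y \<and>
     (\<forall>A\<in>sets G. (LINT w:A|M. Y w) = (LINT w:A|M. Z w))"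

end

theory Submission
  imports Defs
begin

text \<open>
  Take \<open>G\<close> generated by \<open>\<nu>, \<tau>, \<phi>\<close> and \<open>H\<close> generated by \<open>\<nu>, \<tau>, \<phi>, \<theta>\<close>.  Given \<open>H\<close>, the sum \<open>S(u)\<close> is
  a sum of independent terms, so its conditional characteristic function is the product over the
  leaves of the Fourier transform of \<open>\<mu>\<^sub>0\<close> at \<open>\<rho> \<pi>\<^sub>j B(u) O\<^sub>j e\<^sub>3\<close>.  Integrating out \<open>\<theta>\<close> gives the
  Fourier transform of \<open>M\<close>, by induction on the tree: at the root, the third columns of \<open>R M\<^sup>l\<close>
  and \<open>R M\<^sup>r\<close> are the vectors \<open>\<psi>\<^sup>l\<close> and \<open>\<psi>\<^sup>r\<close> relative to the frame formed by the columns of \<open>R\<close>,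
  and the angles of the two subtrees are independent blocks.  The induction needs the root identity
  for every orthogonal \<open>R\<close> and every real \<open>\<rho>\<close>.  It holds because \<open>C[\<zeta>,\<eta>;\<phi>]\<close> is the law of an
  explicit post-collisional velocity, whose Fourier transform does not see the choice of frame; this
  realisation also gives existence and measurability of \<open>C\<close>, and uniqueness is the uniqueness
  theorem for Fourier transforms in several variables.
\<close>

section \<open>The uniform distribution on angles\<close>

lemma sets_unif [measurable_cong, simp]: "sets unif = sets (restrict_space borel {0<..<2*pi})"
  by (simp add: unif_def sets_restrict_space)

lemma space_unif [simp]: "space unif = {0<..<2*pi}"
  by (simp add: unif_def space_restrict_space)

lemma prob_space_unif: "prob_space unif"
proof -
  have "prob_space (uniform_measure lborel {0<..<2*pi::real})"
    by (intro prob_space_uniform_measure) auto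
  then interpret U: prob_space "uniform_measure lborel {0<..<2*pi::real}" .
  have "emeasure (uniform_measure lborel {0<..<2*pi::real}) {0<..<2*pi} = 1"
    by (simp add: emeasure_uniform_measure ennreal_divide_self)
  then show ?thesis
    unfolding unif_def by (intro prob_spaceI) (simp add: emeasure_restrict_space space_restrict_space)
qed

interpretation unif: prob_space unif by (rule prob_space_unif)

lemma measurable_unif_borel: "f \<in> borel_measurable borel \<Longrightarrow> f \<in> borel_measurable unif"
  by (simp add: measurable_restrict_space1 cong: measurable_cong_sets)

lemma integral_unif_continuous:
  fixes f :: "real \<Rightarrow> complex"
  assumes f: "continuous_on UNIV f"
  shows "(\<integral>x. f x \<partial>unif) = integral {0..2*pi} f /\<^sub>R (2*pi)"
proof -
  have [measurable]: "f \<in> borel_measurable borel"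
    using f by (rule borel_measurable_continuous_onI)
  let ?S = "{0<..<2*pi::real}"
  have I: "set_integrable lborel {0..2*pi} f"
    by (rule borel_integrable_atLeastAtMost') (use f continuous_on_subset in blast)
  have I': "set_integrable lborel ?S f"
    by (rule set_integrable_subset[OF I]) auto
  have "(\<integral>x. f x \<partial>unif) = (\<integral>x. indicator ?S x *\<^sub>R f x \<partial>uniform_measure lborel ?S)"
    unfolding unif_def by (subst integral_restrict_space) (auto simp: set_lebesgue_integral_def)
  also have "\<dots> = (\<integral>x. (indicator ?S x / (2*pi)) *\<^sub>R (indicator ?S x *\<^sub>R f x) \<partial>lborel)"
    unfolding uniform_measure_def
    by (subst integral_density[symmetric]) 
       (auto simp: divide_ennreal[symmetric] ennreal_indicator intro!: arg_cong[where f="\<lambda>M. integral\<^sup>L M _"] density_cong)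
  also have "\<dots> = (\<integral>x. (indicator ?S x *\<^sub>R f x) /\<^sub>R (2*pi) \<partial>lborel)"
    by (intro Bochner_Integration.integral_cong) (auto split: split_indicator simp: divide_simps)
  also have "\<dots> = (LINT x:?S|lborel. f x) /\<^sub>R (2*pi)"
    unfolding set_lebesgue_integral_def by (rule integral_scaleR_right)
  also have "(LINT x:?S|lborel. f x) = integral ?S f"
    by (rule set_borel_integral_eq_integral(2)[OF I'])
  also have "integral ?S f = integral {0..2*pi} f"
    using integral_open_interval[of 0 "2*pi" f] by (simp add: box_real)
  finally show ?thesis .
qed

lemma integral_periodic_shift:
  fixes f :: "real \<Rightarrow> complex"
  assumes f: "continuous_on UNIV f" and per: "\<And>x. f (x + 2*pi) = f x" and c: "0 \<le> c" "c \<le> 2*pi"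
  shows "integral {0..2*pi} (\<lambda>x. f (x + c)) = integral {0..2*pi} f"
proof -
  have int: "f integrable_on {a..b}" for a b
    by (intro integrable_continuous_real continuous_on_subset[OF f]) auto
  have sh: "integral {a..b} (\<lambda>x. f (x + d)) = integral {a+d..b+d} f" for a b d
    using integral_shift_Icc_real[of a b f d] by (simp add: o_def add.commute)
  have "integral {0..2*pi} (\<lambda>x. f (x + c)) = integral {c..2*pi+c} f"
    using sh[of 0 "2*pi" c] by simp
  also have "\<dots> = integral {c..2*pi} f + integral {2*pi..2*pi+c} f"
    using c by (intro Henstock_Kurzweil_Integration.integral_combine[symmetric] int) auto
  also have "integral {2*pi..2*pi+c} f = integral {0..c} f"
    using sh[of 0 c "2*pi"] by (simp add: per add.commute)
  also have "integral {c..2*pi} f + integral {0..c} f = integral {0..2*pi} f"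
    using c by (subst add.commute, intro Henstock_Kurzweil_Integration.integral_combine int) auto
  finally show ?thesis .
qed

lemma integral_unif_trig:
  fixes f :: "real \<Rightarrow> complex"
  assumes f: "continuous_on UNIV f"
  shows "(\<integral>x. f (A * cos x + B * sin x) \<partial>unif) = (\<integral>x. f (sqrt (A\<^sup>2 + B\<^sup>2) * cos x) \<partial>unif)"
proof -
  define r where "r = sqrt (A\<^sup>2 + B\<^sup>2)"
  have "\<exists>t. 0 \<le> t \<and> t \<le> 2*pi \<and> A = r * cos t \<and> B = r * sin t"
  proof (cases "r = 0")
    case True
    then have "A = 0" "B = 0" unfolding r_def by (auto simp: sum_power2_eq_zero_iff)
    then show ?thesis using True by (intro exI[of _ 0]) auto
  next
    case False
    then have r2: "r\<^sup>2 = A\<^sup>2 + B\<^sup>2" "r \<noteq> 0" by (auto simp: r_def)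
    then have "(A/r)\<^sup>2 + (B/r)\<^sup>2 = 1"
      by (simp add: power_divide r2(1)[symmetric] flip: add_divide_distrib)
    then obtain t where "0 \<le> t" "t < 2*pi" "A/r = cos t" "B/r = sin t"
      using sincos_total_2pi by metis
    then show ?thesis using False by (intro exI[of _ t]) (auto simp: field_simps)
  qed
  then obtain t where t: "0 \<le> t" "t \<le> 2*pi" "A = r * cos t" "B = r * sin t" by blast
  have *: "A * cos x + B * sin x = r * cos (x + (2*pi - t))" for x
  proof -
    have "cos (x + (2*pi - t)) = cos (x - t)"
      by (metis add_diff_eq cos_periodic diff_add_eq)
    then show ?thesis by (simp add: t cos_diff algebra_simps)
  qed
  have cont: "continuous_on UNIV (\<lambda>x. f (r * cos (x + c)))" for c
    by (intro continuous_on_compose2[OF f] continuous_intros) auto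
  have "integral {0..2*pi} (\<lambda>x. f (r * cos (x + (2*pi - t)))) = integral {0..2*pi} (\<lambda>x. f (r * cos x))"
    using integral_periodic_shift[of "\<lambda>x. f (r * cos x)" "2*pi - t"] cont[of 0] t by simp
  then show ?thesis
    using cont cont[of 0] by (simp add: * integral_unif_continuous r_def[symmetric])
qed

section \<open>Uniqueness of multivariate Fourier transforms\<close>

lemma integral_indicator_eq_of_fourier_eq:
  fixes M N :: "'a measure" and X f :: "'a \<Rightarrow> real"
  assumes fin: "finite_measure M" "finite_measure N" and sets: "sets N = sets M"
    and X: "X \<in> borel_measurable M" and f: "f \<in> borel_measurable M"
    and f_bounds: "\<And>x. 0 \<le> f x" "\<And>x. f x \<le> C"
    and eq: "\<And>s. (CLINT x|M. iexp (s * X x) * f x) = (CLINT x|N. iexp (s * X x) * f x)"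
    and A: "A \<in> sets borel"
  shows "(\<integral>x. indicator A (X x) * f x \<partial>M) = (\<integral>x. indicator A (X x) * f x \<partial>N)"
proof -
  note [measurable] = X f A
  have [measurable]: "X \<in> borel_measurable N" "f \<in> borel_measurable N"
    using X f by (simp_all add: measurable_cong_sets[OF sets refl])
  interpret M: finite_measure M by fact
  interpret N: finite_measure N by fact
  have b: "norm (f x) \<le> C" for x using f_bounds[of x] by auto
  have int: "integrable M f" "integrable N f"
    using b by (auto intro!: M.integrable_const_bound[where B=C] N.integrable_const_bound[where B=C] AE_I2)
  define c where "c = (\<integral>x. f x \<partial>M)"
  have "complex_of_real (\<integral>x. f x \<partial>M) = complex_of_real (\<integral>x. f x \<partial>N)"
    using eq[of 0] by (simp flip: integral_complex_of_real)
  then have c: "c = (\<integral>x. f x \<partial>N)" by (simp add: c_def)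
  have c0: "0 \<le> c" unfolding c_def using f_bounds by (intro integral_nonneg_AE) auto
  show ?thesis
  proof (cases "c = 0")
    case True
    have "AE x in M. f x = 0"
      using True int f_bounds by (subst (asm) c_def, subst (asm) integral_nonneg_eq_0_iff_AE) auto
    moreover have "AE x in N. f x = 0"
      using True int f_bounds by (subst (asm) c, subst (asm) integral_nonneg_eq_0_iff_AE) auto
    ultimately have "(\<integral>x. indicator A (X x) * f x \<partial>M) = (\<integral>x. 0 \<partial>M)"
       "(\<integral>x. indicator A (X x) * f x \<partial>N) = (\<integral>x. 0 \<partial>N)"
      by (auto intro!: integral_eq_zero_AE elim!: eventually_mono)
    then show ?thesis by simp
  next
    case False
    with c0 have cpos: "0 < c" by simp
    have key: "prob_space (density K (\<lambda>x. ennreal (f x / c))) \<and>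
        (\<forall>s. char (distr (density K (\<lambda>x. ennreal (f x / c))) borel X) s = (CLINT x|K. iexp (s * X x) * f x) / c) \<and>
        measure (distr (density K (\<lambda>x. ennreal (f x / c))) borel X) A = (\<integral>x. indicator A (X x) * f x \<partial>K) / c"
      if [measurable]: "X \<in> borel_measurable K" "f \<in> borel_measurable K" 
      and K: "finite_measure K" "integrable K f" "(\<integral>x. f x \<partial>K) = c" for K :: "'a measure"
    proof (intro conjI allI)
      interpret K: finite_measure K by fact
      have "(\<integral>\<^sup>+x. ennreal (f x / c) \<partial>K) = ennreal (\<integral>x. f x / c \<partial>K)"
        using f_bounds cpos K by (intro nn_integral_eq_integral) auto
      also have "\<dots> = 1" using K cpos by simp
      finally show P: "prob_space (density K (\<lambda>x. ennreal (f x / c)))"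
        by (intro prob_spaceI) (simp add: emeasure_density cong: nn_integral_cong)
      have d: "(\<integral>x. g x \<partial>density K (\<lambda>x. ennreal (f x / c))) = (\<integral>x. (f x / c) *\<^sub>R g x \<partial>K)"
        if "g \<in> borel_measurable K" for g :: "'a \<Rightarrow> 'c::{banach, second_countable_topology}"
        using that f_bounds cpos by (intro integral_density) auto
      show "char (distr (density K (\<lambda>x. ennreal (f x / c))) borel X) s = (CLINT x|K. iexp (s * X x) * f x) / c" for s
        unfolding char_def
        by (subst integral_distr) (auto simp: d scaleR_conv_of_real mult_ac simp flip: integral_divide_zero)
      interpret P: prob_space "density K (\<lambda>x. ennreal (f x / c))" by (rule P)
      have "measure (distr (density K (\<lambda>x. ennreal (f x / c))) borel X) A 
          = (\<integral>x. indicator A x \<partial>distr (density K (\<lambda>x. ennreal (f x / c))) borel X)"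
        by simp
      also have "\<dots> = (\<integral>x. indicator A (X x) * f x \<partial>K) / c"
        by (subst integral_distr) (auto simp: d mult_ac simp del: Bochner_Integration.integral_indicator simp flip: integral_divide_zero)
      finally show "measure (distr (density K (\<lambda>x. ennreal (f x / c))) borel X) A = (\<integral>x. indicator A (X x) * f x \<partial>K) / c" .
    qed
    have kM: "prob_space (density M (\<lambda>x. ennreal (f x / c)))" 
      "char (distr (density M (\<lambda>x. ennreal (f x / c))) borel X) s = (CLINT x|M. iexp (s * X x) * f x) / c"
      "measure (distr (density M (\<lambda>x. ennreal (f x / c))) borel X) A = (\<integral>x. indicator A (X x) * f x \<partial>M) / c" for s
      using key[of M] int fin by (auto simp: c_def)
    have kN: "prob_space (density N (\<lambda>x. ennreal (f x / c)))" 
      "char (distr (density N (\<lambda>x. ennreal (f x / c))) borel X) s = (CLINT x|N. iexp (s * X x) * f x) / c"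
      "measure (distr (density N (\<lambda>x. ennreal (f x / c))) borel X) A = (\<integral>x. indicator A (X x) * f x \<partial>N) / c" for s
      using key[of N] int fin by (auto simp: c)
    have "distr (density M (\<lambda>x. ennreal (f x / c))) borel X = distr (density N (\<lambda>x. ennreal (f x / c))) borel X"
    proof (rule Levy_uniqueness)
      show "real_distribution (distr (density M (\<lambda>x. ennreal (f x / c))) borel X)"
        by (intro prob_space.real_distribution_distr kM) simp
      show "real_distribution (distr (density N (\<lambda>x. ennreal (f x / c))) borel X)"
        by (intro prob_space.real_distribution_distr kN) simp
      show "char (distr (density M (\<lambda>x. ennreal (f x / c))) borel X) = char (distr (density N (\<lambda>x. ennreal (f x / c))) borel X)"
        by (rule ext) (simp only: kM kN eq)
    qed
    then have "(\<integral>x. indicator A (X x) * f x \<partial>M) / c = (\<integral>x. indicator A (X x) * f x \<partial>N) / c"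
      by (metis kM(3) kN(3))
    then show ?thesis using cpos by simp
  qed
qed

lemma fourier_marginalize:
  fixes M N :: "'a measure" and X Y w :: "'a \<Rightarrow> real"
  assumes fin: "finite_measure M" "finite_measure N" and sets: "sets N = sets M"
    and X: "X \<in> borel_measurable M" and Y: "Y \<in> borel_measurable M" and w: "w \<in> borel_measurable M"
    and w_bounds: "\<And>x. 0 \<le> w x" "\<And>x. w x \<le> 1"
    and eq: "\<And>s r. (CLINT x|M. w x * iexp (s * X x + r * Y x)) = (CLINT x|N. w x * iexp (s * X x + r * Y x))"
    and A: "A \<in> sets borel"
  shows "(CLINT x|M. w x * indicator A (X x) * iexp (Y x)) = (CLINT x|N. w x * indicator A (X x) * iexp (Y x))"
proof -
  note [measurable] = X Y w A
  have [measurable]: "X \<in> borel_measurable N" "Y \<in> borel_measurable N" "w \<in> borel_measurable N"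
    using X Y w by (simp_all add: measurable_cong_sets[OF sets refl])
  interpret M: finite_measure M by fact
  interpret N: finite_measure N by fact
  have bc: "norm (complex_of_real (w x) * iexp z) \<le> 1" for x z
    using w_bounds[of x] by (simp add: norm_mult)
  have im: "integrable M (\<lambda>x. complex_of_real (w x) * iexp (s * X x + r * Y x))"
    and in': "integrable N (\<lambda>x. complex_of_real (w x) * iexp (s * X x + r * Y x))" for s r
    by (intro M.integrable_const_bound[where B=1] N.integrable_const_bound[where B=1] AE_I2 bc; measurable)+
  define E1 where "E1 = (\<lambda>x. w x * (1 + cos (Y x)))"
  define E2 where "E2 = (\<lambda>x. w x * (1 + sin (Y x)))"
  have eplus: "iexp (a + 1 * y) = iexp a * iexp y" and eminus: "iexp (a + (-1) * y) = iexp a / iexp y" for a y :: real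
    by (simp_all add: exp_add exp_diff distrib_left right_diff_distrib)
  have cos_eq: "complex_of_real (cos y) = (iexp y + 1 / iexp y) / 2"
    and sin_eq: "complex_of_real (sin y) = (iexp y - 1 / iexp y) / (2 * \<i>)" for y
    by (simp_all add: cos_exp_eq sin_exp_eq exp_minus inverse_eq_divide flip: cos_of_real sin_of_real)
  have e1: "iexp (s * X x) * E1 x = w x * iexp (s * X x + 0 * Y x)
      + (w x * iexp (s * X x + 1 * Y x) + w x * iexp (s * X x + (-1) * Y x)) / 2" for s x
    unfolding E1_def eplus eminus
    unfolding cos_eq of_real_mult[of "w x"] of_real_add[of 1] of_real_1
    by (simp add: field_simps)
  have e2: "iexp (s * X x) * E2 x = w x * iexp (s * X x + 0 * Y x)
      + (w x * iexp (s * X x + 1 * Y x) - w x * iexp (s * X x + (-1) * Y x)) / (2 * \<i>)" for s x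
    unfolding E2_def eplus eminus
    unfolding sin_eq of_real_mult[of "w x"] of_real_add[of 1] of_real_1
    by (simp add: field_simps)
  have c1: "(\<integral>x. indicator A (X x) * E1 x \<partial>M) = (\<integral>x. indicator A (X x) * E1 x \<partial>N)"
  proof (rule integral_indicator_eq_of_fourier_eq[OF fin sets X _ _ _ _ A, of _ 2])
    show "E1 \<in> borel_measurable M" unfolding E1_def by measurable
    show "0 \<le> E1 x" for x unfolding E1_def using w_bounds[of x] cos_ge_minus_one[of "Y x"] by (intro mult_nonneg_nonneg) linarith+
    show "E1 x \<le> 2" for x unfolding E1_def using mult_mono[of "w x" 1 "1 + cos (Y x)" 2] w_bounds[of x] cos_le_one[of "Y x"] cos_ge_minus_one[of "Y x"] by linarith
    show "(CLINT x|M. iexp (s * X x) * E1 x) = (CLINT x|N. iexp (s * X x) * E1 x)" for s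
      unfolding e1 using im[of s] in'[of s] by (simp only: eq Bochner_Integration.integral_add Bochner_Integration.integrable_add 
          integrable_divide_zero integral_divide_zero)
  qed
  have c2: "(\<integral>x. indicator A (X x) * E2 x \<partial>M) = (\<integral>x. indicator A (X x) * E2 x \<partial>N)"
  proof (rule integral_indicator_eq_of_fourier_eq[OF fin sets X _ _ _ _ A, of _ 2])
    show "E2 \<in> borel_measurable M" unfolding E2_def by measurable
    show "0 \<le> E2 x" for x unfolding E2_def using w_bounds[of x] sin_ge_minus_one[of "Y x"] by (intro mult_nonneg_nonneg) linarith+
    show "E2 x \<le> 2" for x unfolding E2_def using mult_mono[of "w x" 1 "1 + sin (Y x)" 2] w_bounds[of x] sin_le_one[of "Y x"] sin_ge_minus_one[of "Y x"] by linarith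
    show "(CLINT x|M. iexp (s * X x) * E2 x) = (CLINT x|N. iexp (s * X x) * E2 x)" for s
      unfolding e2 using im[of s] in'[of s] by (simp only: eq Bochner_Integration.integral_add Bochner_Integration.integrable_add 
          Bochner_Integration.integral_diff Bochner_Integration.integrable_diff 
          integrable_divide_zero integral_divide_zero)
  qed
  have c3: "(\<integral>x. indicator A (X x) * w x \<partial>M) = (\<integral>x. indicator A (X x) * w x \<partial>N)"
  proof (rule integral_indicator_eq_of_fourier_eq[OF fin sets X w w_bounds _ A])
    show "(CLINT x|M. iexp (s * X x) * w x) = (CLINT x|N. iexp (s * X x) * w x)" for s
      using eq[of s 0] by (simp add: mult.commute)
  qed
  have split: "w x * indicator A (X x) * iexp (Y x) = 
      complex_of_real (indicator A (X x) * E1 x) + \<i> * complex_of_real (indicator A (X x) * E2 x)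
      - (1 + \<i>) * complex_of_real (indicator A (X x) * w x)" for x
    unfolding E1_def E2_def
    by (auto simp: exp_Euler algebra_simps cos_of_real sin_of_real split: split_indicator)
  have b: "norm (indicator A (X x) * E1 x) \<le> 2" "norm (indicator A (X x) * E2 x) \<le> 2" "norm (indicator A (X x) * w x) \<le> 2" for x
  proof -
    have "0 \<le> 1 + cos (Y x)" "0 \<le> 1 + sin (Y x)" "1 + cos (Y x) \<le> 2" "1 + sin (Y x) \<le> 2"
      using cos_ge_minus_one[of "Y x"] sin_ge_minus_one[of "Y x"] by (auto simp del: cos_ge_minus_one sin_ge_minus_one)
    then show "norm (indicator A (X x) * E1 x) \<le> 2" "norm (indicator A (X x) * E2 x) \<le> 2" "norm (indicator A (X x) * w x) \<le> 2"
      using mult_mono[of "w x" 1 "1 + sin (Y x)" 2] mult_mono[of "w x" 1 "1 + cos (Y x)" 2] w_bounds[of x]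
      by (auto simp: E1_def E2_def abs_mult abs_of_nonneg split: split_indicator)
  qed
  have [measurable]: "E1 \<in> borel_measurable M" "E2 \<in> borel_measurable M" "E1 \<in> borel_measurable N" "E2 \<in> borel_measurable N"
    unfolding E1_def E2_def by measurable
  have iM: "integrable M (\<lambda>x. indicator A (X x) * E1 x)" "integrable M (\<lambda>x. indicator A (X x) * E2 x)" "integrable M (\<lambda>x. indicator A (X x) * w x)"
    using b by (auto intro!: M.integrable_const_bound[where B=2])
  have iN: "integrable N (\<lambda>x. indicator A (X x) * E1 x)" "integrable N (\<lambda>x. indicator A (X x) * E2 x)" "integrable N (\<lambda>x. indicator A (X x) * w x)"
    using b by (auto intro!: N.integrable_const_bound[where B=2])
  show ?thesis
    unfolding split using iM iN
    by (simp only: Bochner_Integration.integral_diff Bochner_Integration.integral_add integral_mult_right_zero integral_complex_of_real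
        Bochner_Integration.integrable_add Bochner_Integration.integrable_diff integrable_mult_right integrable_of_real c1 c2 c3)
qed

theorem fourier_uniqueness:
  fixes M N :: "'a::euclidean_space measure"
  assumes fin: "finite_measure M" "finite_measure N" and sets: "sets M = sets borel" "sets N = sets borel"
    and eq: "\<And>xi. (CLINT x|M. iexp (xi \<bullet> x)) = (CLINT x|N. iexp (xi \<bullet> x))"
  shows "M = N"
proof -
  have sNM: "sets N = sets M" by (simp add: sets)
  have meas: "f \<in> borel_measurable borel \<Longrightarrow> f \<in> borel_measurable M" for f :: "'a \<Rightarrow> real"
    by (simp add: measurable_cong_sets[OF sets(1) refl])
  interpret M: finite_measure M by fact
  interpret N: finite_measure N by fact
  have step: "(CLINT x|M. (\<Prod>i\<in>S. indicator (A i) (x \<bullet> i)::real) * iexp (\<Sum>i\<in>Basis - S. c i * (x \<bullet> i))) =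
        (CLINT x|N. (\<Prod>i\<in>S. indicator (A i) (x \<bullet> i)::real) * iexp (\<Sum>i\<in>Basis - S. c i * (x \<bullet> i)))"
    if "S \<subseteq> Basis" "\<And>i. A i \<in> sets borel" for S c and A :: "'a \<Rightarrow> real set"
    using finite_subset[OF that(1) finite_Basis] that(1)
  proof (induction S arbitrary: c rule: finite_induct)
    case empty
    have "(\<Sum>i\<in>Basis. c i * (x \<bullet> i)) = (\<Sum>i\<in>Basis. c i *\<^sub>R i) \<bullet> x" for x :: 'a
      by (simp add: inner_sum_left inner_commute[of x])
    then show ?case using eq[of "\<Sum>i\<in>Basis. c i *\<^sub>R i"] by simp
  next
    case (insert k S)
    have [measurable]: "A i \<in> sets borel" for i using that by simp
    define w where "w = (\<lambda>x. (\<Prod>i\<in>S. indicator (A i) (x \<bullet> i)::real))"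
    define Y where "Y = (\<lambda>x. (\<Sum>i\<in>Basis - insert k S. c i * (x \<bullet> i)))"
    have "(CLINT x|M. w x * indicator (A k) (x \<bullet> k) * iexp (Y x)) = (CLINT x|N. w x * indicator (A k) (x \<bullet> k) * iexp (Y x))"
    proof (rule fourier_marginalize[OF fin sNM])
      show "(\<lambda>x. x \<bullet> k) \<in> borel_measurable M" "Y \<in> borel_measurable M" "w \<in> borel_measurable M"
        unfolding Y_def w_def by (intro meas; measurable)+
      show "0 \<le> w x" "w x \<le> 1" for x
        unfolding w_def by (auto intro!: prod_nonneg prod_le_1)
      show "(CLINT x|M. w x * iexp (s * (x \<bullet> k) + r * Y x)) = (CLINT x|N. w x * iexp (s * (x \<bullet> k) + r * Y x))" for s r
      proof -
        have e: "s * (x \<bullet> k) + r * Y x = (\<Sum>i\<in>Basis - S. (if i = k then s else r * c i) * (x \<bullet> i))" for x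
        proof -
          have "(\<Sum>i\<in>Basis - S. (if i = k then s else r * c i) * (x \<bullet> i)) =
              (if k = k then s else r * c k) * (x \<bullet> k) + (\<Sum>i\<in>Basis - S - {k}. (if i = k then s else r * c i) * (x \<bullet> i))"
            by (rule sum.remove) (use insert in auto)
          also have "(\<Sum>i\<in>Basis - S - {k}. (if i = k then s else r * c i) * (x \<bullet> i)) = (\<Sum>i\<in>Basis - insert k S. r * (c i * (x \<bullet> i)))"
            by (rule sum.cong) auto
          finally show ?thesis
            unfolding Y_def by (simp add: sum_distrib_left)
        qed
        show ?thesis unfolding e w_def by (rule insert.IH) (use insert in auto)
      qed
    qed fact
    then show ?case
      using insert(1,2) unfolding w_def Y_def by (simp add: mult_ac)
  qed
  have eq': "measure M (box l u) = measure N (box l u)" for l u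
  proof -
    have ind: "(\<Prod>i\<in>Basis. indicator {l\<bullet>i<..<u\<bullet>i} (x \<bullet> i)::real) = indicator (box l u) x" for x
      by (auto simp: box_def indicator_def prod_zero_iff intro!: prod.neutral)
    have "(CLINT x|M. complex_of_real (indicator (box l u) x)) = (CLINT x|N. complex_of_real (indicator (box l u) x))"
      using step[of Basis "\<lambda>i. {l\<bullet>i<..<u\<bullet>i}" "\<lambda>_. 0"] by (simp add: ind del: of_real_prod)
    then show ?thesis
      by (simp add: sets integral_complex_of_real)
  qed
  show ?thesis
  proof (rule measure_eqI_generator_eq)
    let ?E = "range (\<lambda>(a, b). box a b::'a set)"
    show "Int_stable ?E"
      by (auto simp: Int_stable_def box_Int_box)
    show "?E \<subseteq> Pow UNIV" "sets M = sigma_sets UNIV ?E" "sets N = sigma_sets UNIV ?E"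
      by (simp_all add: borel_eq_box sets)
    let ?A = "\<lambda>n::nat. box (- (real n *\<^sub>R One)) (real n *\<^sub>R One) :: 'a set"
    show "range ?A \<subseteq> ?E" "(\<Union>i. ?A i) = UNIV"
      unfolding UN_box_eq_UNIV by auto
    show "emeasure M (?A i) \<noteq> \<infinity>" for i by simp
    show "emeasure M X = emeasure N X" if "X \<in> ?E" for X
      using that by (auto simp: M.emeasure_eq_measure N.emeasure_eq_measure eq')
  qed
qed

section \<open>The collision operator\<close>

lemma orthogonal_matrix_columns_parseval:
  fixes R :: "real^3^3"
  assumes "orthogonal_matrix R"
  shows "(column 1 R \<bullet> x)\<^sup>2 + (column 2 R \<bullet> x)\<^sup>2 + (column 3 R \<bullet> x)\<^sup>2 = x \<bullet> x"
proof -
  have "norm (transpose R *v x) = norm x"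
    using assms by (metis orthogonal_matrix_transpose orthogonal_transformation_matrix orthogonal_transformation_norm 
        matrix_of_matrix_vector_mul matrix_vector_mul_linear)
  then have "(transpose R *v x) \<bullet> (transpose R *v x) = x \<bullet> x"
    by (simp add: norm_eq)
  moreover have "(transpose R *v x) $ i = column i R \<bullet> x" for i
    by (simp add: matrix_vector_mult_def transpose_def column_def inner_vec_def)
  moreover have "y \<bullet> y = (y $ 1)\<^sup>2 + (y $ 2)\<^sup>2 + (y $ 3)\<^sup>2" for y :: "real^3"
    by (simp add: inner_vec_def sum_3 power2_eq_square)
  ultimately show ?thesis by metis
qed

definition onb :: "real^3 \<Rightarrow> real^3 \<Rightarrow> real^3 \<Rightarrow> bool" where
  "onb a b u \<longleftrightarrow> a \<bullet> a = 1 \<and> b \<bullet> b = 1 \<and> u \<bullet> u = 1 \<and> a \<bullet> b = 0 \<and> a \<bullet> u = 0 \<and> b \<bullet> u = 0"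

lemma onb_parseval:
  assumes "onb a b u"
  shows "(a \<bullet> x)\<^sup>2 + (b \<bullet> x)\<^sup>2 + (u \<bullet> x)\<^sup>2 = x \<bullet> x"
proof -
  define R :: "real^3^3" where "R = transpose (vector [a, b, u])"
  have c: "column 1 R = a" "column 2 R = b" "column 3 R = u"
    by (simp_all add: R_def column_def transpose_def vec_eq_iff)
  have "orthogonal_matrix R"
    unfolding orthogonal_matrix 
    using assms by (simp add: R_def vec_eq_iff matrix_matrix_mult_def transpose_def mat_def forall_3 onb_def inner_vec_def sum_3 mult.commute)
  from orthogonal_matrix_columns_parseval[OF this, of x] show ?thesis by (simp add: c)
qed

lemma onb_columns:
  fixes R :: "real^3^3"
  assumes "orthogonal_matrix R"
  shows "onb (column 1 R) (column 2 R) (column 3 R)"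
proof -
  have "(transpose R ** R) $ i $ j = (if i = j then 1 else 0)" for i j
    using assms by (simp add: orthogonal_matrix mat_def)
  moreover have "(transpose R ** R) $ i $ j = column i R \<bullet> column j R" for i j
    by (simp add: matrix_matrix_mult_def transpose_def column_def inner_vec_def)
  ultimately show ?thesis unfolding onb_def by simp
qed

definition perp :: "real^3 \<Rightarrow> real^3" where
  "perp z = (if z $ 1 = 0 \<and> z $ 2 = 0 then vector [1, 0, 0]
     else (1 / sqrt ((z $ 1)\<^sup>2 + (z $ 2)\<^sup>2)) *\<^sub>R vector [- (z $ 2), z $ 1, 0])"

lemma perp_unit: "perp z \<bullet> perp z = 1"
proof (cases "z $ 1 = 0 \<and> z $ 2 = 0")
  case True
  then show ?thesis by (simp add: perp_def inner_vec_def sum_3)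
next
  case False
  then have pos: "(z $ 1)\<^sup>2 + (z $ 2)\<^sup>2 > 0"
    by (simp add: sum_power2_gt_zero_iff)
  then show ?thesis using False
    by (simp add: perp_def inner_vec_def sum_3 power2_eq_square add.commute flip: add_divide_distrib)
qed

lemma perp_orthogonal: "perp z \<bullet> z = 0"
  by (simp add: perp_def inner_vec_def sum_3)

lemma borel_measurable_vec_nth [measurable (raw)]:
  fixes f :: "'a \<Rightarrow> ('b::euclidean_space)^('n::finite)"
  assumes "f \<in> borel_measurable M"
  shows "(\<lambda>x. f x $ i) \<in> borel_measurable M"
  using assms by (rule measurable_compose) (intro borel_measurable_continuous_onI continuous_intros)

lemma borel_measurable_vecI:
  fixes f :: "'a \<Rightarrow> ('b::euclidean_space)^('n::finite)"
  assumes "\<And>i. (\<lambda>x. f x $ i) \<in> borel_measurable M"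
  shows "f \<in> borel_measurable M"
proof (subst borel_measurable_euclidean_space, intro ballI)
  fix k :: "'b^'n" assume "k \<in> Basis"
  then obtain i b where k: "k = axis i b" "b \<in> Basis" by (auto simp: Basis_vec_def)
  show "(\<lambda>x. f x \<bullet> k) \<in> borel_measurable M"
    using assms[of i] by (simp add: k inner_axis)
qed

lemma borel_measurable_cross3 [measurable (raw)]:
  assumes [measurable]: "f \<in> borel_measurable M" "g \<in> borel_measurable M"
  shows "(\<lambda>x. cross3 (f x) (g x)) \<in> borel_measurable M"
proof (rule borel_measurable_vecI)
  show "(\<lambda>x. cross3 (f x) (g x) $ i) \<in> borel_measurable M" for i
    using exhaust_3[of i] by (auto simp: cross3_def)
qed

lemma borel_measurable_perp [measurable]: "perp \<in> borel_measurable borel"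
proof -
  have [measurable]: "(\<lambda>z::real^3. vector [- (z $ 2), z $ 1, 0] :: real^3) \<in> borel_measurable borel"
  proof (rule borel_measurable_vecI)
    show "(\<lambda>x. (vector [- (x $ 2), x $ 1, 0] :: real^3) $ i) \<in> borel_measurable borel" for i :: 3
      using exhaust_3[of i] by auto
  qed
  show ?thesis unfolding perp_def by measurable
qed

lemma perp_frame_parseval:
  assumes u: "u \<bullet> u = 1"
  shows "(norm z * (perp z \<bullet> u))\<^sup>2 + (cross3 z (perp z) \<bullet> u)\<^sup>2 + (u \<bullet> z)\<^sup>2 = z \<bullet> z"
proof (cases "z = 0")
  case False
  define n where "n = norm z"
  have n: "n > 0" "z \<bullet> z = n\<^sup>2" using False by (auto simp: n_def power2_norm_eq_inner)
  have cc: "cross3 z (perp z) \<bullet> cross3 z (perp z) = n\<^sup>2"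
    using norm_cross[of z "perp z"] perp_unit[of z] perp_orthogonal[of z] n
    by (simp add: power_mult_distrib power2_norm_eq_inner inner_commute)
  have "onb (perp z) ((1/n) *\<^sub>R cross3 z (perp z)) ((1/n) *\<^sub>R z)"
    using n perp_unit[of z] perp_orthogonal[of z] cc
    by (simp add: onb_def dot_cross_self power2_eq_square)
  from onb_parseval[OF this, of u] show ?thesis using u n
    by (simp add: n_def[symmetric] power_mult_distrib inner_commute field_simps)
qed simp

text \<open>Post-collisional velocity: \<open>w\<close> plus the projection of the relative velocity \<open>z = v - w\<close> onto
  the direction that makes the angle \<open>p\<close> with \<open>z\<close> and has azimuth \<open>th\<close>.\<close>

definition collide :: "real \<Rightarrow> real^3 \<Rightarrow> real^3 \<Rightarrow> real \<Rightarrow> real^3" where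
  "collide p v w th = w + cos p *\<^sub>R ((cos th * sin p * norm (v - w)) *\<^sub>R perp (v - w)
     + (sin th * sin p) *\<^sub>R cross3 (v - w) (perp (v - w)) + cos p *\<^sub>R (v - w))"

lemma borel_measurable_collide [measurable (raw)]:
  assumes [measurable]: "p \<in> borel_measurable M" "v \<in> borel_measurable M" "w \<in> borel_measurable M" "th \<in> borel_measurable M"
  shows "(\<lambda>x. collide (p x) (v x) (w x) (th x)) \<in> borel_measurable M"
  unfolding collide_def by measurable

definition collision_law :: "(real^3) measure \<Rightarrow> (real^3) measure \<Rightarrow> real \<Rightarrow> (real^3) measure" where
  "collision_law zeta eta p = distr ((zeta \<Otimes>\<^sub>M eta) \<Otimes>\<^sub>M unif) borel (\<lambda>x. collide p (fst (fst x)) (snd (fst x)) (snd x))"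

lemma measurable_unif_id [measurable]: "(\<lambda>x. x) \<in> borel_measurable unif"
  by (rule measurable_unif_borel) simp

text \<open>Bobylev's symmetry: as the azimuth varies, only the angle between \<open>u\<close> and the relative
  velocity matters, so rotating about \<open>u\<close> or about the relative velocity gives the same average.\<close>

lemma integral_unif_iexp_collide:
  assumes onb: "onb a b u"
  shows "(CLINT th|unif. iexp ((rho *\<^sub>R u) \<bullet> collide p v w th)) =
    (CLINT th|unif. iexp (((rho * cos p) *\<^sub>R ((cos th * sin p) *\<^sub>R a + (sin th * sin p) *\<^sub>R b + cos p *\<^sub>R u)) \<bullet> v)
        * iexp (((rho * sin p) *\<^sub>R ((- cos th * cos p) *\<^sub>R a + (- sin th * cos p) *\<^sub>R b + sin p *\<^sub>R u)) \<bullet> w))"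
    (is "?L = ?R")
proof -
  define z where "z = v - w"
  define f where "f = (\<lambda>x. iexp (rho * (u \<bullet> w) + rho * cos p * (sin p * x + cos p * (u \<bullet> z))))"
  have f: "continuous_on UNIV f" unfolding f_def by (intro continuous_intros)
  have u: "u \<bullet> u = 1" using onb by (simp add: onb_def)
  have L: "?L = (\<integral>th. f ((norm z * (perp z \<bullet> u)) * cos th + (cross3 z (perp z) \<bullet> u) * sin th) \<partial>unif)"
  proof (intro Bochner_Integration.integral_cong refl)
    fix th
    have "(rho *\<^sub>R u) \<bullet> collide p v w th = rho * (u \<bullet> w) + rho * cos p * (sin p * ((norm z * (perp z \<bullet> u)) * cos th + (cross3 z (perp z) \<bullet> u) * sin th) + cos p * (u \<bullet> z))"
      unfolding collide_def z_def[symmetric] by (simp add: inner_add_right inner_commute[of u] algebra_simps)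
    then show "iexp ((rho *\<^sub>R u) \<bullet> collide p v w th) = f ((norm z * (perp z \<bullet> u)) * cos th + (cross3 z (perp z) \<bullet> u) * sin th)"
      unfolding f_def by simp
  qed
  have R: "?R = (\<integral>th. f ((a \<bullet> z) * cos th + (b \<bullet> z) * sin th) \<partial>unif)"
  proof (intro Bochner_Integration.integral_cong refl)
    fix th
    have "((rho * c) *\<^sub>R ((cos th * s) *\<^sub>R a + (sin th * s) *\<^sub>R b + c *\<^sub>R u)) \<bullet> v
      + ((rho * s) *\<^sub>R ((- cos th * c) *\<^sub>R a + (- sin th * c) *\<^sub>R b + s *\<^sub>R u)) \<bullet> w
      = rho * ((c\<^sup>2 + s\<^sup>2) * (u \<bullet> w)) + rho * c * (s * ((a \<bullet> z) * cos th + (b \<bullet> z) * sin th) + c * (u \<bullet> z))" for c s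
      unfolding z_def by (simp add: inner_add_left inner_diff_right algebra_simps power2_eq_square)
    from this[of "cos p" "sin p"]
    have *: "((rho * cos p) *\<^sub>R ((cos th * sin p) *\<^sub>R a + (sin th * sin p) *\<^sub>R b + cos p *\<^sub>R u)) \<bullet> v
      + ((rho * sin p) *\<^sub>R ((- cos th * cos p) *\<^sub>R a + (- sin th * cos p) *\<^sub>R b + sin p *\<^sub>R u)) \<bullet> w
      = rho * (u \<bullet> w) + rho * cos p * (sin p * ((a \<bullet> z) * cos th + (b \<bullet> z) * sin th) + cos p * (u \<bullet> z))"
      by simp
    show "iexp (((rho * cos p) *\<^sub>R ((cos th * sin p) *\<^sub>R a + (sin th * sin p) *\<^sub>R b + cos p *\<^sub>R u)) \<bullet> v)
        * iexp (((rho * sin p) *\<^sub>R ((- cos th * cos p) *\<^sub>R a + (- sin th * cos p) *\<^sub>R b + sin p *\<^sub>R u)) \<bullet> w)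
      = f ((a \<bullet> z) * cos th + (b \<bullet> z) * sin th)"
      unfolding f_def *[symmetric] by (simp only: of_real_add distrib_left exp_add)
  qed
  have "(norm z * (perp z \<bullet> u))\<^sup>2 + (cross3 z (perp z) \<bullet> u)\<^sup>2 = (a \<bullet> z)\<^sup>2 + (b \<bullet> z)\<^sup>2"
    using perp_frame_parseval[OF u, of z] onb_parseval[OF onb, of z] by linarith
  then show ?thesis
    unfolding L R by (subst (1 2) integral_unif_trig[OF f]) simp
qed

lemma ft_collision_law:
  assumes zeta: "prob_space zeta" "sets zeta = sets borel" and eta: "prob_space eta" "sets eta = sets borel"
    and onb: "onb a b u"
  shows "ft (collision_law zeta eta p) (rho *\<^sub>R u) =
    (CLINT th|unif. ft zeta ((rho * cos p) *\<^sub>R ((cos th * sin p) *\<^sub>R a + (sin th * sin p) *\<^sub>R b + cos p *\<^sub>R u))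
       * ft eta ((rho * sin p) *\<^sub>R ((- cos th * cos p) *\<^sub>R a + (- sin th * cos p) *\<^sub>R b + sin p *\<^sub>R u)))"
proof -
  note [measurable_cong] = zeta(2) eta(2)
  interpret Z: prob_space zeta by fact
  interpret E: prob_space eta by fact
  interpret ZE: pair_prob_space zeta eta ..
  interpret ZEU: pair_prob_space "zeta \<Otimes>\<^sub>M eta" unif ..
  define l where "l th = (rho * cos p) *\<^sub>R ((cos th * sin p) *\<^sub>R a + (sin th * sin p) *\<^sub>R b + cos p *\<^sub>R u)" for th
  define r where "r th = (rho * sin p) *\<^sub>R ((- cos th * cos p) *\<^sub>R a + (- sin th * cos p) *\<^sub>R b + sin p *\<^sub>R u)" for th
  have [measurable]: "l \<in> borel_measurable borel" "r \<in> borel_measurable borel"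
    unfolding l_def r_def by measurable
  have "ft (collision_law zeta eta p) (rho *\<^sub>R u) = (CLINT x|(zeta \<Otimes>\<^sub>M eta) \<Otimes>\<^sub>M unif. iexp ((rho *\<^sub>R u) \<bullet> collide p (fst (fst x)) (snd (fst x)) (snd x)))"
    unfolding ft_def collision_law_def by (subst integral_distr) (auto simp: case_prod_beta)
  also have "\<dots> = (CLINT x|zeta \<Otimes>\<^sub>M eta. CLINT th|unif. iexp ((rho *\<^sub>R u) \<bullet> collide p (fst x) (snd x) th))"
    by (subst ZEU.integral_fst'[symmetric]) 
      (auto intro!: ZEU.integrable_const_bound[where B=1] simp del: of_real_mult)
  also have "\<dots> = (CLINT x|zeta \<Otimes>\<^sub>M eta. CLINT th|unif. iexp (l th \<bullet> fst x) * iexp (r th \<bullet> snd x))"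
    unfolding l_def r_def by (subst integral_unif_iexp_collide[OF onb]) (rule refl)
  also have "\<dots> = (CLINT th|unif. CLINT x|zeta \<Otimes>\<^sub>M eta. iexp (l th \<bullet> fst x) * iexp (r th \<bullet> snd x))"
    by (subst ZEU.Fubini_integral) 
       (auto intro!: ZEU.integrable_const_bound[where B=1] simp: norm_mult case_prod_beta)
  also have "\<dots> = (CLINT th|unif. ft zeta (l th) * ft eta (r th))"
  proof (intro Bochner_Integration.integral_cong refl)
    fix th
    have "(CLINT x|zeta \<Otimes>\<^sub>M eta. iexp (l th \<bullet> fst x) * iexp (r th \<bullet> snd x)) 
      = (CLINT v|zeta. CLINT w|eta. iexp (l th \<bullet> v) * iexp (r th \<bullet> w))"
      by (subst ZE.integral_fst'[symmetric]) (auto intro!: ZE.integrable_const_bound[where B=1] simp: norm_mult)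
    then show "(CLINT x|zeta \<Otimes>\<^sub>M eta. iexp (l th \<bullet> fst x) * iexp (r th \<bullet> snd x)) = ft zeta (l th) * ft eta (r th)"
      unfolding ft_def by simp
  qed
  finally show ?thesis unfolding l_def r_def .
qed

lemma posbasis_frame:
  assumes "norm u = 1" shows "posbasis (frame_a u) (frame_b u) u"
proof -
  obtain A :: "real^3^3" where A: "rotation_matrix A" "A *v axis 3 1 = u"
    using rotation_matrix_exists_basis[OF _ assms, of 3] by auto
  have u: "column 3 A = u" using A(2) by (simp add: matrix_vector_mul_component flip: matrix_vector_mult_basis)
  have "transpose (vector [column 1 A, column 2 A, column 3 A] :: real^3^3) = A"
    by (simp add: vec_eq_iff transpose_def column_def forall_3)
  then have "posbasis (column 1 A) (column 2 A) u"
    using onb_columns[of A] A(1) u by (simp add: posbasis_def onb_def rotation_matrix_def)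
  then have "posbasis (fst (column 1 A, column 2 A)) (snd (column 1 A, column 2 A)) u" by simp
  then show ?thesis
    unfolding frame_a_def frame_b_def by (rule someI)
qed

lemma ft_zero: "prob_space m \<Longrightarrow> ft m 0 = 1"
  by (simp add: ft_def prob_space.prob_space)

lemma prob_space_collision_law:
  assumes "prob_space zeta" "sets zeta = sets borel" "prob_space eta" "sets eta = sets borel"
  shows "prob_space (collision_law zeta eta p)"
proof -
  note [measurable_cong] = assms(2,4)
  show ?thesis unfolding collision_law_def
    by (intro prob_space.prob_space_distr prob_space_pair prob_space_unif assms) measurable
qed

lemma sets_collision_law [simp]: "sets (collision_law zeta eta p) = sets borel"
  by (simp add: collision_law_def)

lemma Cop_eq_collision_law:
  assumes "prob_space zeta" "sets zeta = sets borel" "prob_space eta" "sets eta = sets borel"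
  shows "Cop zeta eta p = collision_law zeta eta p"
  unfolding Cop_def
proof (rule the_equality)
  have *: "ft (collision_law zeta eta p) xi = (if xi = 0 then 1 else
        (CLINT th|unif. ft zeta ((norm xi * cos p) *\<^sub>R psil p th (xi /\<^sub>R norm xi))
                      * ft eta ((norm xi * sin p) *\<^sub>R psir p th (xi /\<^sub>R norm xi))))" for xi
  proof (cases "xi = 0")
    case True
    then show ?thesis by (simp add: ft_zero prob_space_collision_law[OF assms])
  next
    case False
    define u where "u = xi /\<^sub>R norm xi"
    have "norm u = 1" using False by (simp add: u_def)
    then have "onb (frame_a u) (frame_b u) u"
      using posbasis_frame[of u] by (simp add: posbasis_def onb_def)
    from ft_collision_law[OF assms this, of p "norm xi"] show ?thesis
      using False by (simp add: u_def psil_def psir_def)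
  qed
  then show "prob_space (collision_law zeta eta p) \<and> sets (collision_law zeta eta p) = sets borel \<and>
      (\<forall>xi. ft (collision_law zeta eta p) xi = (if xi = 0 then 1 else
        (CLINT th|unif. ft zeta ((norm xi * cos p) *\<^sub>R psil p th (xi /\<^sub>R norm xi))
                      * ft eta ((norm xi * sin p) *\<^sub>R psir p th (xi /\<^sub>R norm xi)))))"
    by (simp add: prob_space_collision_law[OF assms])
  fix m assume m: "prob_space m \<and> sets m = sets borel \<and>
      (\<forall>xi. ft m xi = (if xi = 0 then 1 else
        (CLINT th|unif. ft zeta ((norm xi * cos p) *\<^sub>R psil p th (xi /\<^sub>R norm xi))
                      * ft eta ((norm xi * sin p) *\<^sub>R psir p th (xi /\<^sub>R norm xi)))))"
  then have "ft m xi = ft (collision_law zeta eta p) xi" for xi by (simp add: *)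
  then show "m = collision_law zeta eta p"
    using m prob_space_collision_law[OF assms] 
    by (intro fourier_uniqueness) (auto simp: ft_def intro: prob_space.finite_measure)
qed

section \<open>Integration over the angles of a tree\<close>

lemma leaves_pos: "0 < leaves t"
  by (induction t) auto

lemma prob_space_sets_Ctree:
  assumes "prob_space mu0" "sets mu0 = sets borel"
  shows "prob_space (Ctree t mu0 phi) \<and> sets (Ctree t mu0 phi) = sets borel"
  using assms
  by (induction t arbitrary: phi) (simp_all add: Cop_eq_collision_law prob_space_collision_law)

lemma Ctree_Node:
  assumes "prob_space mu0" "sets mu0 = sets borel"
  shows "Ctree (Node l r) mu0 phi =
    collision_law (Ctree l mu0 phi) (Ctree r mu0 (shiftv (leaves l) phi)) (phi (leaves l + leaves r - 1))"
  using prob_space_sets_Ctree[OF assms] by (simp add: Cop_eq_collision_law)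

lemma measurable_Ctree:
  assumes mu0: "prob_space mu0" "sets mu0 = sets borel"
    and phi: "\<And>i. 1 \<le> i \<Longrightarrow> (\<lambda>w. phi w i) \<in> borel_measurable N"
  shows "(\<lambda>w. Ctree t mu0 (phi w)) \<in> measurable N (prob_algebra borel)"
  using phi
proof (induction t arbitrary: phi)
  case Leaf
  have "mu0 \<in> space (prob_algebra borel)" using mu0 by (simp add: space_prob_algebra)
  then show ?case by simp
next
  case (Node l r)
  have [measurable]: "(\<lambda>w. Ctree l mu0 (phi w)) \<in> measurable N (prob_algebra borel)"
    by (rule Node.IH) (rule Node.prems)
  have [measurable]: "(\<lambda>w. Ctree r mu0 (shiftv (leaves l) (phi w))) \<in> measurable N (prob_algebra borel)"
    unfolding shiftv_def by (intro Node.IH Node.prems) (use leaves_pos[of l] in linarith)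
  have [measurable]: "(\<lambda>w. phi w (leaves l + leaves r - 1)) \<in> borel_measurable N"
    using leaves_pos[of l] leaves_pos[of r] by (intro Node.prems) linarith
  have "unif \<in> space (prob_algebra unif)" by (simp add: space_prob_algebra prob_space_unif)
  then have [measurable]: "(\<lambda>w. (Ctree l mu0 (phi w) \<Otimes>\<^sub>M Ctree r mu0 (shiftv (leaves l) (phi w))) \<Otimes>\<^sub>M unif) 
     \<in> measurable N (prob_algebra ((borel \<Otimes>\<^sub>M borel) \<Otimes>\<^sub>M unif))"
    by measurable
  show ?case
    unfolding Ctree_Node[OF mu0] collision_law_def
    by (rule measurable_distr_prob_space2[where M="(borel \<Otimes>\<^sub>M borel) \<Otimes>\<^sub>M unif"]) measurable
qed

lemma pistar_measurable:
  assumes "\<And>i. 1 \<le> i \<Longrightarrow> (\<lambda>w. phi w i) \<in> borel_measurable N"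
  shows "(\<lambda>w. pistar t (phi w) j) \<in> borel_measurable N"
  using assms
proof (induction t arbitrary: phi j)
  case (Node l r)
  have [measurable]: "(\<lambda>w. pistar l (phi w) j) \<in> borel_measurable N" for j
    by (rule Node.IH) (rule Node.prems)
  have [measurable]: "(\<lambda>w. pistar r (shiftv (leaves l) (phi w)) j) \<in> borel_measurable N" for j
    unfolding shiftv_def by (intro Node.IH Node.prems) (use leaves_pos[of l] in linarith)
  have [measurable]: "(\<lambda>w. phi w (leaves l + leaves r - 1)) \<in> borel_measurable N"
    using leaves_pos[of l] leaves_pos[of r] by (intro Node.prems) linarith
  show ?case by simp
qed simp

lemma borel_measurable_matrix_mult:
  fixes f g :: "'a \<Rightarrow> real^'n::finite^'n"
  assumes [measurable]: "f \<in> borel_measurable M" "g \<in> borel_measurable M"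
  shows "(\<lambda>x. f x ** g x) \<in> borel_measurable M"
  by (intro borel_measurable_vecI) (simp add: matrix_matrix_mult_def)

lemma borel_measurable_matrix_vector_mult:
  fixes f :: "'a \<Rightarrow> real^'n::finite^'n"
  assumes [measurable]: "f \<in> borel_measurable M" "g \<in> borel_measurable M"
  shows "(\<lambda>x. f x *v g x) \<in> borel_measurable M"
  by (intro borel_measurable_vecI) (simp add: matrix_vector_mult_def)

lemma borel_measurable_Ml_Mr:
  assumes [measurable]: "f \<in> borel_measurable M" "g \<in> borel_measurable M"
  shows "(\<lambda>x. Ml (f x) (g x)) \<in> borel_measurable M" "(\<lambda>x. Mr (f x) (g x)) \<in> borel_measurable M"
proof -
  show "(\<lambda>x. Ml (f x) (g x)) \<in> borel_measurable M"
  proof (intro borel_measurable_vecI)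
    show "(\<lambda>x. Ml (f x) (g x) $ i $ j) \<in> borel_measurable M" for i j
      using exhaust_3[of i] exhaust_3[of j] by (auto simp: Ml_def)
  qed
  show "(\<lambda>x. Mr (f x) (g x)) \<in> borel_measurable M"
  proof (intro borel_measurable_vecI)
    show "(\<lambda>x. Mr (f x) (g x) $ i $ j) \<in> borel_measurable M" for i j
      using exhaust_3[of i] exhaust_3[of j] by (auto simp: Mr_def)
  qed
qed

lemma Ostar_measurable:
  assumes "\<And>i. i \<in> {1..<leaves t} \<Longrightarrow> (\<lambda>w. phi w i) \<in> borel_measurable N"
    and "\<And>i. i \<in> {1..<leaves t} \<Longrightarrow> (\<lambda>w. th w i) \<in> borel_measurable N"
  shows "(\<lambda>w. Ostar t (phi w) (th w) j) \<in> borel_measurable N"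
  using assms
proof (induction t arbitrary: phi th j)
  case (Node l r)
  have l: "(\<lambda>w. Ostar l (phi w) (th w) j) \<in> borel_measurable N" for j
    by (rule Node.IH) (use Node.prems in auto)
  have r: "(\<lambda>w. Ostar r (shiftv (leaves l) (phi w)) (shiftv (leaves l) (th w)) j) \<in> borel_measurable N" for j
    unfolding shiftv_def using leaves_pos[of l] by (intro Node.IH Node.prems) auto
  have p: "leaves l + leaves r - 1 \<in> {1..<leaves (Node l r)}" 
    using leaves_pos[of l] leaves_pos[of r] by (simp add: Suc_le_eq)
  show ?case 
    using borel_measurable_matrix_mult[OF borel_measurable_Ml_Mr(1)[OF Node.prems(1)[OF p] Node.prems(2)[OF p]] l[of j]]
          borel_measurable_matrix_mult[OF borel_measurable_Ml_Mr(2)[OF Node.prems(1)[OF p] Node.prems(2)[OF p]] r[of "j - leaves l"]]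
    by (cases "j \<le> leaves l") simp_all
qed simp

lemma Ostar_cong:
  assumes "\<And>i. i \<in> {1..<leaves t} \<Longrightarrow> th i = th' i"
  shows "Ostar t phi th j = Ostar t phi th' j"
  using assms
proof (induction t arbitrary: phi th th' j)
  case (Node l r)
  have l: "Ostar l phi th j = Ostar l phi th' j" for j
    by (rule Node.IH) (use Node.prems in auto)
  have r: "Ostar r (shiftv (leaves l) phi) (shiftv (leaves l) th) j = Ostar r (shiftv (leaves l) phi) (shiftv (leaves l) th') j" for j
    unfolding shiftv_def using leaves_pos[of l] by (intro Node.IH Node.prems) auto
  have "th (leaves l + leaves r - 1) = th' (leaves l + leaves r - 1)"
    using leaves_pos[of l] leaves_pos[of r] by (intro Node.prems) (simp add: Suc_le_eq)
  then show ?case by (simp add: l r)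
qed simp

lemma borel_measurable_ft [measurable (raw)]:
  assumes m: "prob_space m" "sets m = sets borel" and [measurable]: "f \<in> borel_measurable N"
  shows "(\<lambda>x. ft m (f x)) \<in> borel_measurable N"
proof -
  note [measurable_cong] = m(2)
  interpret prob_space m by fact
  show ?thesis unfolding ft_def by measurable
qed

lemma norm_ft_le:
  assumes m: "prob_space m" "sets m = sets borel"
  shows "norm (ft m xi) \<le> 1"
proof -
  note [measurable_cong] = m(2)
  interpret prob_space m by fact
  have "norm (ft m xi) \<le> (\<integral>x. norm (iexp (xi \<bullet> x)) \<partial>m)"
    unfolding ft_def by (rule integral_norm_bound)
  then show ?thesis by (simp add: prob_space)
qed

lemma norm_prod_ft_le:
  assumes m: "prob_space m" "sets m = sets borel"
  shows "norm (\<Prod>j\<in>J. ft m (f j)) \<le> 1"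
  unfolding prod_norm[symmetric] by (intro prod_le_1) (auto intro: norm_ft_le[OF m])

lemma orthogonal_matrix_Ml_Mr: "orthogonal_matrix (Ml p s)" "orthogonal_matrix (Mr p s)"
proof -
  show "orthogonal_matrix (Ml p s)"
    unfolding orthogonal_matrix vec_eq_iff forall_3 
    by (simp add: Ml_def matrix_matrix_mult_def transpose_def mat_def sum_3, intro conjI)
       (use sin_cos_squared_add[of p] sin_cos_squared_add[of s] in algebra)+
  show "orthogonal_matrix (Mr p s)"
    unfolding orthogonal_matrix vec_eq_iff forall_3 
    by (simp add: Mr_def matrix_matrix_mult_def transpose_def mat_def sum_3, intro conjI)
       (use sin_cos_squared_add[of p] sin_cos_squared_add[of s] in algebra)+
qed

lemma matrix_vector_mult_columns3: "(R::real^3^3) *v vector [a, b, c] = a *\<^sub>R column 1 R + b *\<^sub>R column 2 R + c *\<^sub>R column 3 R"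
  by (simp add: matrix_vector_mult_def vec_eq_iff sum_3 column_def mult.commute)

lemma Ml_Mr_e3:
  "Ml p s *v e3 = vector [cos s * sin p, sin s * sin p, cos p]"
  "Mr p s *v e3 = vector [- cos s * cos p, - sin s * cos p, sin p]"
  by (simp_all add: Ml_def Mr_def e3_def matrix_vector_mult_def vec_eq_iff sum_3 forall_3)

lemma integral_PiM_unif_insert:
  fixes f :: "('i \<Rightarrow> real) \<Rightarrow> complex"
  assumes f: "f \<in> borel_measurable (PiM (insert i I) (\<lambda>_. unif))" "\<And>x. norm (f x) \<le> 1"
  shows "(\<integral>x. f x \<partial>PiM (insert i I) (\<lambda>_. unif)) = (\<integral>s. (\<integral>x. f (x(i := s)) \<partial>PiM I (\<lambda>_. unif)) \<partial>unif)"
proof -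
  interpret P: prob_space "PiM I (\<lambda>_. unif)" by (intro prob_space_PiM prob_space_unif)
  interpret UP: pair_prob_space unif "PiM I (\<lambda>_. unif)" ..
  have m: "(\<lambda>(x, X). X(i := x)) \<in> unif \<Otimes>\<^sub>M PiM I (\<lambda>_. unif) \<rightarrow>\<^sub>M PiM (insert i I) (\<lambda>_. unif)"
    unfolding case_prod_beta by (intro measurable_fun_upd[where J=I]) auto
  have "(\<integral>x. f x \<partial>PiM (insert i I) (\<lambda>_. unif)) 
     = (\<integral>x. f x \<partial>distr (unif \<Otimes>\<^sub>M PiM I (\<lambda>_. unif)) (PiM (insert i I) (\<lambda>_. unif)) (\<lambda>(x, X). X(i := x)))"
    using distr_pair_PiM_eq_PiM[of I "\<lambda>_. unif" i] prob_space_unif by simp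
  also have "\<dots> = (\<integral>x. f ((snd x)(i := fst x)) \<partial>(unif \<Otimes>\<^sub>M PiM I (\<lambda>_. unif)))"
    by (subst integral_distr[OF m f(1)]) (simp add: case_prod_beta)
  also have "\<dots> = (\<integral>s. (\<integral>x. f (x(i := s)) \<partial>PiM I (\<lambda>_. unif)) \<partial>unif)"
  proof (subst UP.integral_fst'[symmetric])
    show "integrable (unif \<Otimes>\<^sub>M PiM I (\<lambda>_. unif)) (\<lambda>x. f ((snd x)(i := fst x)))"
      using measurable_compose[OF m f(1)] f(2) 
      by (intro UP.integrable_const_bound[where B=1]) (auto simp: case_prod_beta)
  qed simp
  finally show ?thesis .
qed

lemma integral_PiM_unif_split:
  fixes f g :: "('i \<Rightarrow> real) \<Rightarrow> complex"
  assumes IJ: "I \<inter> J = {}" "finite I" "finite J"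
    and f: "f \<in> borel_measurable (PiM I (\<lambda>_. unif))" "\<And>x. norm (f x) \<le> 1"
    and g: "g \<in> borel_measurable (PiM J (\<lambda>_. unif))" "\<And>x. norm (g x) \<le> 1"
    and f_cong: "\<And>x y. (\<And>i. i \<in> I \<Longrightarrow> x i = y i) \<Longrightarrow> f x = f y"
    and g_cong: "\<And>x y. (\<And>i. i \<in> J \<Longrightarrow> x i = y i) \<Longrightarrow> g x = g y"
  shows "(\<integral>x. f x * g x \<partial>PiM (I \<union> J) (\<lambda>_. unif)) = (\<integral>x. f x \<partial>PiM I (\<lambda>_. unif)) * (\<integral>x. g x \<partial>PiM J (\<lambda>_. unif))"
proof -
  interpret product_prob_space "\<lambda>_::'i. unif" "I \<union> J" ..
  interpret P: prob_space "PiM (I \<union> J) (\<lambda>_. unif)" by (intro prob_space_PiM prob_space_unif)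
  have fm: "f \<in> borel_measurable (PiM (I \<union> J) (\<lambda>_. unif))"
  proof -
    have "(\<lambda>x. f (restrict x I)) \<in> borel_measurable (PiM (I \<union> J) (\<lambda>_. unif))"
      by (rule measurable_compose[OF measurable_restrict_subset f(1)]) auto
    moreover have "f (restrict x I) = f x" for x by (rule f_cong) simp
    ultimately show ?thesis by simp
  qed
  have gm: "g \<in> borel_measurable (PiM (I \<union> J) (\<lambda>_. unif))"
  proof -
    have "(\<lambda>x. g (restrict x J)) \<in> borel_measurable (PiM (I \<union> J) (\<lambda>_. unif))"
      by (rule measurable_compose[OF measurable_restrict_subset g(1)]) auto
    moreover have "g (restrict x J) = g x" for x by (rule g_cong) simp
    ultimately show ?thesis by simp
  qed
  have "integrable (PiM (I \<union> J) (\<lambda>_. unif)) (\<lambda>x. f x * g x)"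
    using fm gm f(2) g(2) by (intro P.integrable_const_bound[where B=1] AE_I2) (auto simp: norm_mult intro: mult_le_one)
  from product_integral_fold[OF IJ this]
  have "(\<integral>x. f x * g x \<partial>PiM (I \<union> J) (\<lambda>_. unif)) = (\<integral>x. (\<integral>y. f (merge I J (x, y)) * g (merge I J (x, y)) \<partial>PiM J (\<lambda>_. unif)) \<partial>PiM I (\<lambda>_. unif))" .
  moreover have "f (merge I J (x, y)) = f x" for x y by (rule f_cong) (use IJ in auto)
  moreover have "g (merge I J (x, y)) = g y" for x y by (rule g_cong) (use IJ in auto)
  ultimately show ?thesis by simp
qed

lemma integral_PiM_unif_reindex:
  fixes g :: "('i \<Rightarrow> real) \<Rightarrow> complex"
  assumes f: "inj_on f I" "f \<in> I \<rightarrow> K" and g: "g \<in> borel_measurable (PiM I (\<lambda>_. unif))"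
    and g_cong: "\<And>x y. (\<And>i. i \<in> I \<Longrightarrow> x i = y i) \<Longrightarrow> g x = g y"
  shows "(\<integral>x. g (\<lambda>i. x (f i)) \<partial>PiM K (\<lambda>_. unif)) = (\<integral>x. g x \<partial>PiM I (\<lambda>_. unif))"
    and "(\<lambda>x. g (\<lambda>i. x (f i))) \<in> borel_measurable (PiM K (\<lambda>_. unif))"
proof -
  have m: "(\<lambda>\<omega>. \<lambda>n\<in>I. \<omega> (f n)) \<in> PiM K (\<lambda>_. unif) \<rightarrow>\<^sub>M PiM I (\<lambda>_. unif)"
    using f by (intro measurable_restrict measurable_component_singleton) auto
  have c: "g (\<lambda>n\<in>I. x (f n)) = g (\<lambda>i. x (f i))" for x by (rule g_cong) simp
  have "(\<integral>x. g x \<partial>PiM I (\<lambda>_. unif)) = (\<integral>x. g x \<partial>distr (PiM K (\<lambda>_. unif)) (PiM I (\<lambda>_. unif)) (\<lambda>\<omega>. \<lambda>n\<in>I. \<omega> (f n)))"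
    using distr_PiM_reindex[of K "\<lambda>_. unif" f I] f prob_space_unif by simp
  also have "\<dots> = (\<integral>x. g (\<lambda>i. x (f i)) \<partial>PiM K (\<lambda>_. unif))"
    by (subst integral_distr[OF m g]) (simp add: c)
  finally show "(\<integral>x. g (\<lambda>i. x (f i)) \<partial>PiM K (\<lambda>_. unif)) = (\<integral>x. g x \<partial>PiM I (\<lambda>_. unif))" by simp
  show "(\<lambda>x. g (\<lambda>i. x (f i))) \<in> borel_measurable (PiM K (\<lambda>_. unif))"
    using measurable_compose[OF m g] by (simp add: c)
qed

definition leaf_prod :: "(real^3) measure \<Rightarrow> tree \<Rightarrow> (nat \<Rightarrow> real) \<Rightarrow> real \<Rightarrow> real^3^3 \<Rightarrow> (nat \<Rightarrow> real) \<Rightarrow> complex" where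
  "leaf_prod mu0 t phi rho R th =
     (\<Prod>j\<in>{1..leaves t}. ft mu0 ((rho * pistar t phi j) *\<^sub>R (R *v (Ostar t phi th j *v e3))))"

lemma leaf_prod_cong:
  "(\<And>i. i \<in> {1..<leaves t} \<Longrightarrow> th i = th' i) \<Longrightarrow> leaf_prod mu0 t phi rho R th = leaf_prod mu0 t phi rho R th'"
  unfolding leaf_prod_def using Ostar_cong[of t th th'] by simp

lemma leaf_prod_Node:
  fixes l r phi
  defines "p \<equiv> phi (leaves l + leaves r - 1)"
  shows "leaf_prod mu0 (Node l r) phi rho R th =
    leaf_prod mu0 l phi (rho * cos p) (R ** Ml p (th (leaves l + leaves r - 1))) th *
    leaf_prod mu0 r (shiftv (leaves l) phi) (rho * sin p) (R ** Mr p (th (leaves l + leaves r - 1))) (shiftv (leaves l) th)"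
proof -
  let ?f = "\<lambda>j. ft mu0 ((rho * pistar (Node l r) phi j) *\<^sub>R (R *v (Ostar (Node l r) phi th j *v e3)))"
  have "leaf_prod mu0 (Node l r) phi rho R th = prod ?f {1..leaves l + leaves r}"
    by (simp add: leaf_prod_def)
  also have "{1..leaves l + leaves r} = {1..leaves l} \<union> {leaves l + 1..leaves l + leaves r}" by auto
  also have "prod ?f \<dots> = prod ?f {1..leaves l} * prod ?f {leaves l + 1..leaves l + leaves r}"
    by (rule prod.union_disjoint) auto
  also have "prod ?f {leaves l + 1..leaves l + leaves r} = (\<Prod>j\<in>{1..leaves r}. ?f (j + leaves l))"
    using prod.shift_bounds_cl_nat_ivl[of ?f 1 "leaves l" "leaves r"] by (simp add: add.commute)
  finally show ?thesis
    unfolding leaf_prod_def p_def by (simp add: matrix_mul_assoc[symmetric] matrix_vector_mul_assoc mult_ac)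
qed

lemma borel_measurable_leaf_prod:
  assumes mu0: "prob_space mu0" "sets mu0 = sets borel"
    and phi: "\<And>i. 1 \<le> i \<Longrightarrow> (\<lambda>w. phi w i) \<in> borel_measurable N"
    and th: "\<And>i. i \<in> {1..<leaves t} \<Longrightarrow> (\<lambda>w. th w i) \<in> borel_measurable N"
    and R: "R \<in> borel_measurable N"
  shows "(\<lambda>w. leaf_prod mu0 t (phi w) rho (R w) (th w)) \<in> borel_measurable N"
proof -
  have [measurable]: "(\<lambda>w. pistar t (phi w) j) \<in> borel_measurable N" for j
    by (rule pistar_measurable) (rule phi)
  have [measurable]: "(\<lambda>w. R w *v (Ostar t (phi w) (th w) j *v e3)) \<in> borel_measurable N" for j
    by (intro borel_measurable_matrix_vector_mult R Ostar_measurable phi th) auto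
  show ?thesis unfolding leaf_prod_def
    by (intro borel_measurable_prod borel_measurable_ft[OF mu0]) measurable
qed

lemma norm_leaf_prod_le:
  "prob_space mu0 \<Longrightarrow> sets mu0 = sets borel \<Longrightarrow> norm (leaf_prod mu0 t phi rho R th) \<le> 1"
  unfolding leaf_prod_def by (rule norm_prod_ft_le)

lemma integral_leaf_prod:
  assumes mu0: "prob_space mu0" "sets mu0 = sets borel" and "orthogonal_matrix R"
  shows "(\<integral>th. leaf_prod mu0 t phi rho R th \<partial>PiM {1..<leaves t} (\<lambda>_. unif)) = ft (Ctree t mu0 phi) (rho *\<^sub>R (R *v e3))"
  using assms(3)
proof (induction t arbitrary: phi rho R)
  case Leaf
  interpret P: prob_space "PiM {} (\<lambda>_::nat. unif)" by (intro prob_space_PiM prob_space_unif)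
  show ?case by (simp add: leaf_prod_def P.prob_space)
next
  case (Node l r)
  define nl nr where "nl = leaves l" and "nr = leaves r"
  have n: "nl \<ge> 1" "nr \<ge> 1" using leaves_pos[of l] leaves_pos[of r] by (auto simp: nl_def nr_def)
  define p where "p = phi (nl + nr - 1)"
  define I J where "I = {1..<nl}" and "J = {nl..<nl + nr - 1}"
  have IJ: "I \<inter> J = {}" "finite I" "finite J" "nl + nr - 1 \<notin> I" "nl + nr - 1 \<notin> J" "{1..<nl + nr} = insert (nl + nr - 1) (I \<union> J)"
    using n by (auto simp: I_def J_def)
  define F where "F s th = leaf_prod mu0 l phi (rho * cos p) (R ** Ml p s) th" for s th
  define G where "G s th = leaf_prod mu0 r (shiftv nl phi) (rho * sin p) (R ** Mr p s) th" for s th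
  have coord: "(\<lambda>x. x i) \<in> borel_measurable (PiM K (\<lambda>_. unif))" if "i \<in> K" for i :: nat and K
    using measurable_compose[OF measurable_component_singleton[OF that] measurable_unif_id] .
  have Fm: "F s \<in> borel_measurable (PiM I (\<lambda>_. unif))" for s
    unfolding F_def by (intro borel_measurable_leaf_prod mu0 coord) (auto simp: I_def nl_def)
  have Gm: "G s \<in> borel_measurable (PiM {1..<nr} (\<lambda>_. unif))" for s
    unfolding G_def by (intro borel_measurable_leaf_prod mu0 coord) (auto simp: nr_def)
  have Fc: "F s x = F s y" if "\<And>i. i \<in> I \<Longrightarrow> x i = y i" for s x y
    unfolding F_def by (rule leaf_prod_cong) (use that in \<open>auto simp: I_def nl_def\<close>)
  have Gc: "G s x = G s y" if "\<And>i. i \<in> {1..<nr} \<Longrightarrow> x i = y i" for s x y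
    unfolding G_def by (rule leaf_prod_cong) (use that in \<open>auto simp: nr_def\<close>)
  have Fb: "norm (F s x) \<le> 1" and Gb: "norm (G s x) \<le> 1" for s x
    unfolding F_def G_def by (rule norm_leaf_prod_le[OF mu0])+
  have sh: "inj_on (\<lambda>i. i + nl - 1) {1..<nr}" "(\<lambda>i. i + nl - 1) \<in> {1..<nr} \<rightarrow> J"
    using n by (auto simp: inj_on_def J_def)
  have Gc': "G s (shiftv nl x) = G s (shiftv nl y)" if "\<And>i. i \<in> J \<Longrightarrow> x i = y i" for s x y
    by (rule Gc) (use that sh in \<open>auto simp: shiftv_def Pi_iff\<close>)
  note Gint = integral_PiM_unif_reindex[OF sh Gm Gc, folded shiftv_def]
  have eq: "leaf_prod mu0 (Node l r) phi rho R th = F (th (nl + nr - 1)) th * G (th (nl + nr - 1)) (shiftv nl th)" for th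
    unfolding F_def G_def by (subst leaf_prod_Node) (simp add: nl_def nr_def p_def)
  have m: "leaf_prod mu0 (Node l r) phi rho R \<in> borel_measurable (PiM (insert (nl + nr - 1) (I \<union> J)) (\<lambda>_. unif))"
    unfolding IJ(6)[symmetric]
    by (intro borel_measurable_leaf_prod mu0 coord) (auto simp: nl_def nr_def)
  have "(\<integral>th. leaf_prod mu0 (Node l r) phi rho R th \<partial>PiM {1..<leaves (Node l r)} (\<lambda>_. unif))
    = (\<integral>th. leaf_prod mu0 (Node l r) phi rho R th \<partial>PiM (insert (nl + nr - 1) (I \<union> J)) (\<lambda>_. unif))"
    unfolding IJ(6)[symmetric] by (simp add: nl_def nr_def)
  also have "\<dots> = (\<integral>s. (\<integral>x. leaf_prod mu0 (Node l r) phi rho R (x(nl + nr - 1 := s)) \<partial>PiM (I \<union> J) (\<lambda>_. unif)) \<partial>unif)"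
    by (rule integral_PiM_unif_insert[OF m norm_leaf_prod_le[OF mu0]])
  also have "\<dots> = (\<integral>s. (\<integral>x. F s x * G s (shiftv nl x) \<partial>PiM (I \<union> J) (\<lambda>_. unif)) \<partial>unif)"
  proof -
    have "F s (x(nl + nr - 1 := s)) = F s x" for s x by (rule Fc) (use IJ in auto)
    moreover have "G s (shiftv nl (x(nl + nr - 1 := s))) = G s (shiftv nl x)" for s x by (rule Gc') (use IJ in auto)
    ultimately show ?thesis by (simp add: eq)
  qed
  also have "\<dots> = (\<integral>s. (\<integral>x. F s x \<partial>PiM I (\<lambda>_. unif)) * (\<integral>x. G s (shiftv nl x) \<partial>PiM J (\<lambda>_. unif)) \<partial>unif)"
    by (subst integral_PiM_unif_split[OF IJ(1-3) Fm Fb Gint(2) Gb Fc Gc']) auto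
  also have "\<dots> = (\<integral>s. (\<integral>x. F s x \<partial>PiM I (\<lambda>_. unif)) * (\<integral>x. G s x \<partial>PiM {1..<nr} (\<lambda>_. unif)) \<partial>unif)"
    by (subst Gint(1)) auto
  also have "\<dots> = (\<integral>s. ft (Ctree l mu0 phi) ((rho * cos p) *\<^sub>R ((R ** Ml p s) *v e3)) 
      * ft (Ctree r mu0 (shiftv nl phi)) ((rho * sin p) *\<^sub>R ((R ** Mr p s) *v e3)) \<partial>unif)"
    unfolding F_def G_def I_def nl_def nr_def
    by (simp only: Node.IH orthogonal_matrix_mul[OF Node.prems] orthogonal_matrix_Ml_Mr)
  also have "\<dots> = ft (collision_law (Ctree l mu0 phi) (Ctree r mu0 (shiftv nl phi)) p) (rho *\<^sub>R column 3 R)"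
    using prob_space_sets_Ctree[OF mu0]
    by (subst ft_collision_law[OF _ _ _ _ onb_columns[OF Node.prems]])
       (auto simp: matrix_vector_mul_assoc[symmetric] Ml_Mr_e3 matrix_vector_mult_columns3)
  also have "\<dots> = ft (Ctree (Node l r) mu0 phi) (rho *\<^sub>R (R *v e3))"
    by (simp add: Ctree_Node[OF mu0] p_def nl_def nr_def e3_def matrix_vector_mult_columns3 del: Ctree.simps)
  finally show ?case .
qed

section \<open>Product laws\<close>

lemma prob_space_density:
  assumes "f \<in> borel_measurable M" "(\<integral>\<^sup>+x. f x \<partial>M) = 1"
  shows "prob_space (density M f)"
proof (rule prob_spaceI)
  have "(\<integral>\<^sup>+x. f x * indicator (space M) x \<partial>M) = (\<integral>\<^sup>+x. f x \<partial>M)"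
    by (intro nn_integral_cong) auto
  then show "emeasure (density M f) (space (density M f)) = 1"
    using assms by (simp add: emeasure_density)
qed

lemma prob_space_nu_law:
  assumes "0 \<le> t" shows "prob_space (nu_law t)"
proof -
  define c where "c = 1 - exp (- t)"
  have c: "0 \<le> c" "c < 1" using assms by (auto simp: c_def)
  have s: "(\<lambda>n. exp (- t) * c ^ n) sums (exp (- t) * (1 / (1 - c)))"
    using c by (intro sums_mult geometric_sums) auto
  have "(\<integral>\<^sup>+n. ennreal (exp (- t) * c ^ (n - 1)) \<partial>count_space {1..}) = (\<integral>\<^sup>+n. ennreal (exp (- t) * c ^ (Suc n - 1)) \<partial>count_space UNIV)"
    by (rule nn_integral_bij_count_space[symmetric])
       (auto simp: bij_betw_def image_def Suc_le_eq gr0_conv_Suc)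
  also have "\<dots> = (\<Sum>n. ennreal (exp (- t) * c ^ n))"
    by (simp add: nn_integral_count_space_nat)
  also have "\<dots> = ennreal (exp (- t) * (1 / (1 - c)))"
    using s c by (intro suminf_ennreal_eq) auto
  also have "\<dots> = 1" by (simp add: c_def)
  finally show ?thesis
    unfolding nu_law_def c_def[symmetric] by (intro prob_space_density) auto
qed

lemma sets_nu_law: "sets (nu_law t) = sets (count_space {1..})"
  by (simp add: nu_law_def)

lemma sets_beta_law: "sets (beta_law b) = sets (restrict_space borel {0..pi})"
  by (simp add: beta_law_def sets_restrict_space)

lemma prob_space_beta_law:
  assumes b_meas: "b \<in> borel_measurable (restrict_space borel {-1<..<1})"
    and b_nonneg: "\<And>x. x \<in> {-1<..<1} \<Longrightarrow> b x \<ge> 0"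
    and b_even: "\<And>x. x \<in> {-1<..<1} \<Longrightarrow> x \<noteq> 0 \<Longrightarrow> b x = b (- x)"
    and b_norm: "(\<integral>\<^sup>+ x\<in>{0<..<1}. ennreal (b x) \<partial>lborel) = 1"
  shows "prob_space (beta_law b)"
proof -
  define b' where "b' x = indicator {-1<..<1} x *\<^sub>R b x" for x
  have [measurable]: "b' \<in> borel_measurable borel"
    using b_meas unfolding b'_def by (subst (asm) borel_measurable_restrict_space_iff) auto
  define h where "h x = ennreal (b' x) * indicator {0<..<1} x" for x
  have [measurable]: "h \<in> borel_measurable borel" unfolding h_def by measurable
  have h1: "(\<integral>\<^sup>+x. h x \<partial>lborel) = 1"
    unfolding b_norm[symmetric] h_def by (intro nn_integral_cong) (auto simp: b'_def split: split_indicator)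
  have bcos: "b (cos x) * sin x / 2 = b' (cos x) * sin x / 2" if "x \<in> {0..pi}" for x
  proof (cases "x = 0 \<or> x = pi")
    case False
    then have "-1 < cos x" "cos x < 1"
      using that cos_monotone_0_pi[of x pi] cos_monotone_0_pi[of 0 x] by auto
    then show ?thesis by (simp add: b'_def)
  qed auto
  have "(\<integral>\<^sup>+x. ennreal (b (cos x) * sin x / 2) \<partial>restrict_space lborel {0..pi})
      = (\<integral>\<^sup>+x. ennreal (b' (cos x) * sin x / 2) * indicator {0..pi} x \<partial>lborel)"
    by (subst nn_integral_restrict_space) (auto intro!: nn_integral_cong simp: bcos split: split_indicator)
  also have "\<dots> = (\<integral>\<^sup>+x. ennreal (b' (- (- cos x)) / 2) * ennreal (sin x) * indicator {0..pi} x \<partial>lborel)"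
  proof (intro nn_integral_cong)
    fix x
    have "0 \<le> b' (cos x)" using b_nonneg by (auto simp: b'_def split: split_indicator)
    then show "ennreal (b' (cos x) * sin x / 2) * indicator {0..pi} x = ennreal (b' (- (- cos x)) / 2) * ennreal (sin x) * indicator {0..pi} x"
      using sin_ge_zero[of x] by (auto simp flip: ennreal_mult split: split_indicator)
  qed
  also have "\<dots> = (\<integral>\<^sup>+x. ennreal (b' (- x) / 2) * indicator {- cos 0..- cos pi} x \<partial>lborel)"
    by (rule nn_integral_substitution_aux[symmetric]) (auto intro!: derivative_eq_intros continuous_intros sin_ge_zero)
  also have "\<dots> = (\<integral>\<^sup>+x. (h x + h (- x)) / 2 \<partial>lborel)"
  proof (intro nn_integral_cong_AE)
    have "AE x in lborel. x \<noteq> 0 \<and> x \<noteq> 1 \<and> x \<noteq> (-1::real)" using AE_lborel_singleton by auto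
    then show "AE x in lborel. ennreal (b' (- x) / 2) * indicator {- cos 0..- cos pi} x = (h x + h (- x)) / 2"
    proof eventually_elim
      case (elim x)
      have "b' (- x) = b' x" using b_even[of x] elim by (auto simp: b'_def split: split_indicator)
      moreover have "0 \<le> b' x" using b_nonneg by (auto simp: b'_def split: split_indicator)
      ultimately show ?case using elim 
        by (auto simp: h_def divide_ennreal[symmetric] split: split_indicator)
    qed
  qed
  also have "\<dots> = ((\<integral>\<^sup>+x. h x \<partial>lborel) + (\<integral>\<^sup>+x. h (- x) \<partial>lborel)) / 2"
    by (simp add: nn_integral_divide nn_integral_add)
  also have "(\<integral>\<^sup>+x. h (- x) \<partial>lborel) = (\<integral>\<^sup>+x. h x \<partial>lborel)"
    by (subst (2) nn_integral_real_affine[where c="-1" and t=0]) auto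
  also have "((\<integral>\<^sup>+x. h x \<partial>lborel) + (\<integral>\<^sup>+x. h x \<partial>lborel)) / 2 = 1"
    by (simp add: h1 ennreal_divide_self)
  finally have 1: "(\<integral>\<^sup>+x. ennreal (b (cos x) * sin x / 2) \<partial>restrict_space lborel {0..pi}) = 1" .
  have m: "(\<lambda>x. ennreal (b (cos x) * sin x / 2)) \<in> borel_measurable (restrict_space lborel {0..pi})"
  proof (subst measurable_cong)
    show "x \<in> space (restrict_space lborel {0..pi}) \<Longrightarrow> ennreal (b (cos x) * sin x / 2) = ennreal (b' (cos x) * sin x / 2)" for x
      by (simp add: space_restrict_space bcos)
    show "(\<lambda>x. ennreal (b' (cos x) * sin x / 2)) \<in> borel_measurable (restrict_space lborel {0..pi})"
      supply measurable_unif_id [measurable del]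
      by (intro measurable_restrict_space1) measurable
  qed
  show ?thesis
    unfolding beta_law_def using m 1 by (rule prob_space_density)
qed

lemma integral_pair_bounded:
  fixes f :: "'a \<times> 'b \<Rightarrow> 'c::{banach, second_countable_topology}"
  assumes "prob_space M" "prob_space N" "f \<in> borel_measurable (M \<Otimes>\<^sub>M N)" "\<And>x. norm (f x) \<le> C"
  shows "(\<integral>x. f x \<partial>(M \<Otimes>\<^sub>M N)) = (\<integral>x. (\<integral>y. f (x, y) \<partial>N) \<partial>M)"
proof -
  interpret M: prob_space M by fact
  interpret N: prob_space N by fact
  interpret MN: pair_prob_space M N ..
  show ?thesis
    by (rule MN.integral_fst'[symmetric]) (use assms in \<open>auto intro!: MN.integrable_const_bound[where B=C]\<close>)
qed

lemma integral_pair5_bounded: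
  fixes f :: "_ \<Rightarrow> 'c::{banach, second_countable_topology}"
  assumes p: "prob_space M1" "prob_space M2" "prob_space M3" "prob_space M4" "prob_space M5"
    and f: "f \<in> borel_measurable (M1 \<Otimes>\<^sub>M (M2 \<Otimes>\<^sub>M (M3 \<Otimes>\<^sub>M (M4 \<Otimes>\<^sub>M M5))))" "\<And>x. norm (f x) \<le> C"
  shows "(\<integral>x. f x \<partial>(M1 \<Otimes>\<^sub>M (M2 \<Otimes>\<^sub>M (M3 \<Otimes>\<^sub>M (M4 \<Otimes>\<^sub>M M5))))) =
    (\<integral>x1. (\<integral>x2. (\<integral>x3. (\<integral>x4. (\<integral>x5. f (x1, x2, x3, x4, x5) \<partial>M5) \<partial>M4) \<partial>M3) \<partial>M2) \<partial>M1)"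
proof -
  note pp = p prob_space_pair
  have m1: "(\<lambda>y. f (x1, y)) \<in> borel_measurable (M2 \<Otimes>\<^sub>M (M3 \<Otimes>\<^sub>M (M4 \<Otimes>\<^sub>M M5)))" if "x1 \<in> space M1" for x1
    using measurable_compose[OF measurable_Pair1'[OF that] f(1)] .
  have m2: "(\<lambda>y. f (x1, x2, y)) \<in> borel_measurable (M3 \<Otimes>\<^sub>M (M4 \<Otimes>\<^sub>M M5))" if "x1 \<in> space M1" "x2 \<in> space M2" for x1 x2
    using measurable_compose[OF measurable_Pair1'[OF that(2)] m1[OF that(1)]] .
  have m3: "(\<lambda>y. f (x1, x2, x3, y)) \<in> borel_measurable (M4 \<Otimes>\<^sub>M M5)" if "x1 \<in> space M1" "x2 \<in> space M2" "x3 \<in> space M3" for x1 x2 x3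
    using measurable_compose[OF measurable_Pair1'[OF that(3)] m2[OF that(1,2)]] .
  have "(\<integral>x. f x \<partial>(M1 \<Otimes>\<^sub>M (M2 \<Otimes>\<^sub>M (M3 \<Otimes>\<^sub>M (M4 \<Otimes>\<^sub>M M5))))) = (\<integral>x1. (\<integral>y. f (x1, y) \<partial>(M2 \<Otimes>\<^sub>M (M3 \<Otimes>\<^sub>M (M4 \<Otimes>\<^sub>M M5)))) \<partial>M1)"
    by (rule integral_pair_bounded[where C=C]) (intro pp f)+
  also have "\<dots> = (\<integral>x1. (\<integral>x2. (\<integral>y. f (x1, x2, y) \<partial>(M3 \<Otimes>\<^sub>M (M4 \<Otimes>\<^sub>M M5))) \<partial>M2) \<partial>M1)"
    by (intro Bochner_Integration.integral_cong refl integral_pair_bounded[where C=C] pp m1 f(2))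
  also have "\<dots> = (\<integral>x1. (\<integral>x2. (\<integral>x3. (\<integral>y. f (x1, x2, x3, y) \<partial>(M4 \<Otimes>\<^sub>M M5)) \<partial>M3) \<partial>M2) \<partial>M1)"
    by (intro Bochner_Integration.integral_cong refl integral_pair_bounded[where C=C] pp m2 f(2))
  also have "\<dots> = (\<integral>x1. (\<integral>x2. (\<integral>x3. (\<integral>x4. (\<integral>x5. f (x1, x2, x3, x4, x5) \<partial>M5) \<partial>M4) \<partial>M3) \<partial>M2) \<partial>M1)"
    by (intro Bochner_Integration.integral_cong refl integral_pair_bounded[where C=C] pp m3 f(2))
  finally show ?thesis .
qed

lemma integral_PiM_prod:
  fixes h :: "'i \<Rightarrow> 'a \<Rightarrow> complex"
  assumes M: "prob_space M" and J: "finite J" "J \<subseteq> I" and h: "\<And>j. j \<in> J \<Longrightarrow> h j \<in> borel_measurable M" "\<And>j x. norm (h j x) \<le> 1"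
  shows "(\<integral>x. (\<Prod>j\<in>J. h j (x j)) \<partial>PiM I (\<lambda>_. M)) = (\<Prod>j\<in>J. \<integral>x. h j x \<partial>M)"
proof -
  interpret prob_space M by fact
  interpret product_prob_space "\<lambda>_::'i. M" I ..
  have r: "(\<lambda>x. restrict x J) \<in> PiM I (\<lambda>_. M) \<rightarrow>\<^sub>M PiM J (\<lambda>_. M)"
    by (rule measurable_restrict_subset[OF J(2)])
  have "(\<lambda>x. \<Prod>j\<in>J. h j (x j)) \<in> borel_measurable (PiM J (\<lambda>_. M))"
  proof (intro borel_measurable_prod)
    show "(\<lambda>x. h j (x j)) \<in> borel_measurable (PiM J (\<lambda>_. M))" if "j \<in> J" for j
      using measurable_component_singleton[OF that, of "\<lambda>_. M"] h(1)[OF that] by (rule measurable_compose)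
  qed
  then have "(\<integral>x. (\<Prod>j\<in>J. h j (x j)) \<partial>PiM J (\<lambda>_. M)) = (\<integral>x. (\<Prod>j\<in>J. h j (restrict x J j)) \<partial>PiM I (\<lambda>_. M))"
    by (subst distr_PiM_restrict_finite[OF J, symmetric], subst integral_distr[OF r]) auto
  also have "\<dots> = (\<integral>x. (\<Prod>j\<in>J. h j (x j)) \<partial>PiM I (\<lambda>_. M))"
    by (intro Bochner_Integration.integral_cong refl prod.cong) auto
  finally show ?thesis
    using h by (subst (asm) product_integral_prod[OF J(1)])
      (auto intro!: finite_measure.integrable_const_bound[OF prob_space.finite_measure[OF M], where B=1])
qed

lemma indep_vars_PiM_components:
  fixes M :: "'i \<Rightarrow> 'a measure"
  assumes I: "I \<noteq> {}" and M: "\<And>i. i \<in> I \<Longrightarrow> prob_space (M i)"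
  shows "prob_space.indep_vars (PiM I M) M (\<lambda>i x. x i) I"
proof -
  interpret prob_space "PiM I M" by (rule prob_space_PiM[OF M])
  show ?thesis
  proof (subst indep_vars_iff_distr_eq_PiM'[OF I])
    show "i \<in> I \<Longrightarrow> random_variable (M i) (\<lambda>x. x i)" for i by simp
    have "distr (PiM I M) (PiM I M) (\<lambda>x. \<lambda>i\<in>I. x i) = distr (PiM I M) (PiM I M) (\<lambda>x. x)"
      by (intro distr_cong) (auto simp: space_PiM)
    also have "\<dots> = PiM I M" by simp
    also have "\<dots> = PiM I (\<lambda>i. distr (PiM I M) (M i) (\<lambda>x. x i))"
      by (intro PiM_cong refl distr_PiM_component[symmetric] M)
    finally show "distr (PiM I M) (PiM I M) (\<lambda>x. \<lambda>i\<in>I. x i) = PiM I (\<lambda>i. distr (PiM I M) (M i) (\<lambda>x. x i))" .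
  qed
qed

lemma leaf_prod_char_sum:
  assumes mu0: "prob_space mu0" "sets mu0 = sets borel"
  shows "\<exists>(Q :: (nat \<Rightarrow> real) measure) (N :: nat) (Z :: nat \<Rightarrow> (nat \<Rightarrow> real) \<Rightarrow> real).
     prob_space Q \<and> prob_space.indep_vars Q (\<lambda>_. borel) Z {..<N} \<and>
     (\<forall>rho. leaf_prod mu0 t phi rho R th = char (distr Q borel (\<lambda>x. \<Sum>k<N. Z k x)) rho)"
proof -
  note [measurable_cong] = mu0(2)
  define c where "c k = pistar t phi (Suc k) *\<^sub>R (R *v (Ostar t phi th (Suc k) *v e3))" for k
  define D where "D k = distr mu0 borel (\<lambda>x. c k \<bullet> x)" for k
  define Q where "Q = PiM {..<leaves t} D"
  have D: "prob_space (D k)" "sets (D k) = sets borel" for k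
    unfolding D_def by (auto intro!: prob_space.prob_space_distr mu0)
  interpret Q: prob_space Q unfolding Q_def by (intro prob_space_PiM D)
  have "Q.indep_vars D (\<lambda>k x. x k) {..<leaves t}"
    unfolding Q_def using leaves_pos[of t] by (intro indep_vars_PiM_components D) auto
  then have ind: "Q.indep_vars (\<lambda>_. borel) (\<lambda>k x. x k) {..<leaves t}"
    using Q.indep_vars_compose2[of D "\<lambda>k x. x k" "{..<leaves t}" "\<lambda>_ x. x" "\<lambda>_. borel"] 
    by (simp add: measurable_cong_sets[OF D(2) refl])
  have "leaf_prod mu0 t phi rho R th = char (distr Q borel (\<lambda>x. \<Sum>k<leaves t. x k)) rho" for rho
  proof -
    have d: "distr Q borel (\<lambda>x. x k) = D k" if "k < leaves t" for k
    proof -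
      have "distr Q borel (\<lambda>x. x k) = distr Q (D k) (\<lambda>x. x k)"
        by (intro distr_cong) (auto simp: D)
      also have "\<dots> = D k"
        unfolding Q_def using that by (intro distr_PiM_component D) auto
      finally show ?thesis .
    qed
    have "char (distr Q borel (\<lambda>x. \<Sum>k<leaves t. x k)) rho = (\<Prod>k<leaves t. char (D k) rho)"
      by (subst Q.char_distr_sum[OF ind]) (auto simp: d)
    also have "\<dots> = (\<Prod>k<leaves t. ft mu0 (rho *\<^sub>R c k))"
      unfolding char_def D_def ft_def by (subst integral_distr) auto
    also have "\<dots> = leaf_prod mu0 t phi rho R th"
      unfolding leaf_prod_def c_def by (simp add: prod.atLeast1_atMost_eq)
    finally show ?thesis by simp
  qed
  with ind show ?thesis
    by (intro exI[of _ Q] exI[of _ "leaves t"] exI[of _ "\<lambda>k x. x k"]) (simp add: Q.prob_space_axioms)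
qed

section \<open>The two sigma-algebras\<close>

instance tree :: countable by countable_datatype

definition hist_space :: "(nat \<times> (nat \<Rightarrow> tree) \<times> (nat \<Rightarrow> real)) measure" where
  "hist_space = count_space {1..} \<Otimes>\<^sub>M (TS \<Otimes>\<^sub>M PiM {1..} (\<lambda>_. restrict_space borel {0..pi}))"

definition angle_space :: "(nat \<times> (nat \<Rightarrow> tree) \<times> (nat \<Rightarrow> real) \<times> (nat \<Rightarrow> real)) measure" where
  "angle_space = count_space {1..} \<Otimes>\<^sub>M (TS \<Otimes>\<^sub>M (PiM {1..} (\<lambda>_. restrict_space borel {0..pi})
     \<Otimes>\<^sub>M PiM {1..} (\<lambda>_. restrict_space borel {0<..<2*pi})))"

definition hist_proj :: "omega \<Rightarrow> nat \<times> (nat \<Rightarrow> tree) \<times> (nat \<Rightarrow> real)" where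
  "hist_proj w = (fst w, fst (snd w), fst (snd (snd w)))"

definition angle_proj :: "omega \<Rightarrow> nat \<times> (nat \<Rightarrow> tree) \<times> (nat \<Rightarrow> real) \<times> (nat \<Rightarrow> real)" where
  "angle_proj w = (fst w, fst (snd w), fst (snd (snd w)), fst (snd (snd (snd w))))"

definition Gsig :: "omega measure" where "Gsig = vimage_algebra (space Omega) hist_proj hist_space"
definition Hsig :: "omega measure" where "Hsig = vimage_algebra (space Omega) angle_proj angle_space"

lemma space_Gsig [simp]: "space Gsig = space Omega" and space_Hsig [simp]: "space Hsig = space Omega"
  by (simp_all add: Gsig_def Hsig_def)

lemma hist_proj_space: "hist_proj \<in> space Omega \<rightarrow> space hist_space"
  and angle_proj_space: "angle_proj \<in> space Omega \<rightarrow> space angle_space"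
  by (auto simp: Omega_def hist_space_def angle_space_def space_pair_measure hist_proj_def angle_proj_def)

lemma hist_proj_measurable: "hist_proj \<in> Gsig \<rightarrow>\<^sub>M hist_space"
  unfolding Gsig_def by (rule measurable_vimage_algebra1[OF hist_proj_space])

lemma angle_proj_measurable: "angle_proj \<in> Hsig \<rightarrow>\<^sub>M angle_space"
  unfolding Hsig_def by (rule measurable_vimage_algebra1[OF angle_proj_space])

lemma sets_Gsig_subset: "sets Gsig \<subseteq> sets Hsig"
proof -
  have "hist_proj \<in> Hsig \<rightarrow>\<^sub>M hist_space"
  proof -
    have "(\<lambda>x. (fst x, fst (snd x), fst (snd (snd x)))) \<in> angle_space \<rightarrow>\<^sub>M hist_space"
      unfolding angle_space_def hist_space_def by measurable
    from measurable_compose[OF angle_proj_measurable this] show ?thesis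
      by (simp add: angle_proj_def hist_proj_def[abs_def])
  qed
  then show ?thesis
    unfolding Gsig_def sets_vimage_algebra2[OF hist_proj_space] by (auto dest: measurable_sets)
qed

lemma sets_Hsig_subset: "sets Hsig \<subseteq> sets Omega"
proof -
  have "angle_proj \<in> Omega \<rightarrow>\<^sub>M angle_space"
    unfolding angle_proj_def[abs_def] angle_space_def Omega_def by measurable
  then show ?thesis
    unfolding Hsig_def sets_vimage_algebra2[OF angle_proj_space] by (auto dest: measurable_sets)
qed

lemma measurable_Gsig_Hsig: "f \<in> Gsig \<rightarrow>\<^sub>M N \<Longrightarrow> f \<in> Hsig \<rightarrow>\<^sub>M N"
  using measurable_mono[of N N Gsig Hsig] sets_Gsig_subset by auto

lemma measurable_Hsig_Omega: "f \<in> Hsig \<rightarrow>\<^sub>M N \<Longrightarrow> f \<in> Omega \<rightarrow>\<^sub>M N"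
  using measurable_mono[of N N Hsig Omega] sets_Hsig_subset by auto

lemma nu_Gsig: "nu \<in> Gsig \<rightarrow>\<^sub>M count_space {1..}"
  using measurable_compose[OF hist_proj_measurable, of fst] unfolding hist_space_def
  by (simp add: hist_proj_def nu_def[abs_def])

lemma nu_Gsig_UNIV: "nu \<in> Gsig \<rightarrow>\<^sub>M count_space UNIV"
  by (rule measurable_compose[OF nu_Gsig]) simp

lemma tau_Gsig:
  assumes "1 \<le> n" shows "tau n \<in> Gsig \<rightarrow>\<^sub>M count_space UNIV"
proof -
  have "(\<lambda>x. fst (snd x)) \<in> hist_space \<rightarrow>\<^sub>M PiM {1..} (\<lambda>n. count_space (trees n))"
    unfolding hist_space_def TS_def by measurable
  from measurable_compose[OF this measurable_component_singleton[of n]]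
  have "(\<lambda>x. fst (snd x) n) \<in> hist_space \<rightarrow>\<^sub>M count_space (trees n)" using assms by simp
  from measurable_compose[OF hist_proj_measurable this] 
  have "tau n \<in> Gsig \<rightarrow>\<^sub>M count_space (trees n)" by (simp add: hist_proj_def tau_def[abs_def])
  then show ?thesis by (rule measurable_compose) simp
qed

definition cur_tree :: "omega \<Rightarrow> tree" where "cur_tree w = tau (nu w) w"

lemma cur_tree_Gsig: "cur_tree \<in> Gsig \<rightarrow>\<^sub>M count_space UNIV"
  unfolding cur_tree_def[abs_def]
  by (rule measurable_compose_countable'[OF tau_Gsig nu_Gsig]) auto

lemma leaves_tau: "w \<in> space Omega \<Longrightarrow> 1 \<le> n \<Longrightarrow> leaves (tau n w) = n"
  by (auto simp: Omega_def space_pair_measure TS_def space_PiM PiE_def Pi_iff trees_def tau_def)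

lemma nu_ge: "w \<in> space Omega \<Longrightarrow> 1 \<le> nu w"
  by (auto simp: Omega_def space_pair_measure nu_def)

lemma phis_Gsig:
  assumes "1 \<le> i" shows "(\<lambda>w. phis w i) \<in> borel_measurable Gsig"
proof -
  have "(\<lambda>x. snd (snd x)) \<in> hist_space \<rightarrow>\<^sub>M PiM {1..} (\<lambda>_. restrict_space borel {0..pi})"
    unfolding hist_space_def by measurable
  from measurable_compose[OF this measurable_component_singleton[of i]]
  have "(\<lambda>x. snd (snd x) i) \<in> hist_space \<rightarrow>\<^sub>M restrict_space borel {0..pi}" using assms by simp
  from measurable_compose[OF hist_proj_measurable this] 
  have "(\<lambda>w. phis w i) \<in> Gsig \<rightarrow>\<^sub>M restrict_space borel {0..pi}" by (simp add: hist_proj_def phis_def[abs_def])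
  then show ?thesis by (rule measurable_compose) (simp add: measurable_restrict_space1)
qed

lemma thetas_Hsig:
  assumes "1 \<le> i" shows "(\<lambda>w. thetas w i) \<in> borel_measurable Hsig"
proof -
  have "(\<lambda>x. snd (snd (snd x))) \<in> angle_space \<rightarrow>\<^sub>M PiM {1..} (\<lambda>_. restrict_space borel {0<..<2*pi})"
    unfolding angle_space_def by measurable
  from measurable_compose[OF this measurable_component_singleton[of i]]
  have "(\<lambda>x. snd (snd (snd x)) i) \<in> angle_space \<rightarrow>\<^sub>M restrict_space borel {0<..<2*pi}" using assms by simp
  from measurable_compose[OF angle_proj_measurable this] 
  have "(\<lambda>w. thetas w i) \<in> Hsig \<rightarrow>\<^sub>M restrict_space borel {0<..<2*pi}" by (simp add: angle_proj_def thetas_def[abs_def])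
  then show ?thesis by (rule measurable_compose) (simp add: measurable_restrict_space1)
qed

lemma phis_Hsig: "1 \<le> i \<Longrightarrow> (\<lambda>w. phis w i) \<in> borel_measurable Hsig"
  by (intro measurable_Gsig_Hsig phis_Gsig)

lemma Xs_Omega_PiM: "Xs \<in> Omega \<rightarrow>\<^sub>M PiM {1..} (\<lambda>_. borel)"
  unfolding Xs_def[abs_def] Omega_def by measurable

lemma Xs_Omega: "1 \<le> i \<Longrightarrow> (\<lambda>w. Xs w i) \<in> borel_measurable Omega"
  using measurable_compose[OF Xs_Omega_PiM measurable_component_singleton[of i]] by simp

lemma Mrand_Gsig:
  assumes "prob_space mu0" "sets mu0 = sets borel"
  shows "Mrand mu0 \<in> Gsig \<rightarrow>\<^sub>M prob_algebra borel"
  unfolding Mrand_def[abs_def] cur_tree_def[symmetric]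
  by (rule measurable_compose_countable[OF measurable_Ctree[OF assms phis_Gsig] cur_tree_Gsig])

lemma pi_rv_Gsig:
  assumes "1 \<le> n" shows "(\<lambda>w. \<lambda>j\<in>{1..n}. pi_rv j n w) \<in> Gsig \<rightarrow>\<^sub>M PiM {1..n} (\<lambda>_. borel)"
proof (rule measurable_restrict)
  show "pi_rv j n \<in> borel_measurable Gsig" for j
    unfolding pi_rv_def[abs_def]
    by (rule measurable_compose_countable[OF pistar_measurable[OF phis_Gsig] tau_Gsig[OF assms]])
qed

lemma O_rv_Hsig:
  assumes "1 \<le> n" shows "(\<lambda>w. \<lambda>j\<in>{1..n}. O_rv j n w) \<in> Hsig \<rightarrow>\<^sub>M PiM {1..n} (\<lambda>_. borel)"
proof (rule measurable_restrict)
  show "O_rv j n \<in> borel_measurable Hsig" for j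
    unfolding O_rv_def[abs_def]
    by (rule measurable_compose_countable[OF Ostar_measurable measurable_Gsig_Hsig[OF tau_Gsig[OF assms]]])
       (auto intro: phis_Hsig thetas_Hsig)
qed

lemma measurable_vimage_algebra_eq:
  fixes h :: "'a \<Rightarrow> real"
  assumes h: "h \<in> borel_measurable (vimage_algebra X g M)" and g: "g \<in> X \<rightarrow> space M"
    and xy: "x \<in> X" "y \<in> X" "g x = g y"
  shows "h x = h y"
proof -
  have "h -` {h x} \<inter> X \<in> sets (vimage_algebra X g M)"
    using measurable_sets[OF h, of "{h x}"] by simp
  then obtain A where A: "h -` {h x} \<inter> X = g -` A \<inter> X"
    unfolding sets_vimage_algebra2[OF g] by auto
  have "x \<in> g -` A \<inter> X" using xy by (simp flip: A)
  then have "y \<in> g -` A \<inter> X" using xy by simp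
  then show ?thesis by (simp flip: A)
qed

fun comb :: "nat \<Rightarrow> tree" where
  "comb 0 = Leaf"
| "comb (Suc n) = Node Leaf (comb n)"

lemma leaves_comb [simp]: "leaves (comb n) = Suc n"
  by (induction n) auto

definition sample_point :: "real \<Rightarrow> real^3 \<Rightarrow> omega" where
  "sample_point c x = (1, \<lambda>n\<in>{1..}. comb (n - 1), \<lambda>_\<in>{1..}. 0, \<lambda>_\<in>{1..}. c, \<lambda>_\<in>{1..}. x)"

lemma sample_point_space: "c \<in> {0<..<2*pi} \<Longrightarrow> sample_point c x \<in> space Omega"
  by (auto simp: sample_point_def Omega_def space_pair_measure TS_def space_PiM trees_def space_restrict_space)

lemma proj_sample_point:
  "hist_proj (sample_point c x) = hist_proj (sample_point c' x')"
  "angle_proj (sample_point c x) = angle_proj (sample_point c x')"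
  by (simp_all add: hist_proj_def angle_proj_def sample_point_def)

lemma O_rv_not_Gsig:
  assumes n: "2 \<le> n" shows "(\<lambda>w. \<lambda>j\<in>{1..n}. O_rv j n w) \<notin> Gsig \<rightarrow>\<^sub>M PiM {1..n} (\<lambda>_. borel)"
proof
  assume "(\<lambda>w. \<lambda>j\<in>{1..n}. O_rv j n w) \<in> Gsig \<rightarrow>\<^sub>M PiM {1..n} (\<lambda>_. borel)"
  from measurable_compose[OF this measurable_component_singleton[of 1]] n
  have [measurable]: "(\<lambda>w. O_rv 1 n w) \<in> borel_measurable Gsig" by simp
  have m: "(\<lambda>w. O_rv 1 n w $ 1 $ 2) \<in> borel_measurable Gsig" by measurable
  have v: "O_rv 1 n (sample_point c 0) $ 1 $ 2 = sin c" for c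
  proof -
    obtain k where k: "n = Suc (Suc k)" using n by (metis Suc_le_D numeral_2_eq_2 Suc_le_mono)
    show ?thesis
      by (simp add: O_rv_def tau_def phis_def thetas_def sample_point_def k Ml_def)
  qed
  have "O_rv 1 n (sample_point (pi/2) 0) $ 1 $ 2 = O_rv 1 n (sample_point pi 0) $ 1 $ 2"
    by (rule measurable_vimage_algebra_eq[OF m[unfolded Gsig_def] hist_proj_space])
       (auto intro!: sample_point_space proj_sample_point)
  then show False by (simp only: v) simp
qed

lemma sets_Gsig_psubset: "sets Gsig \<subset> sets Hsig"
proof -
  have "sets Gsig \<noteq> sets Hsig"
    using O_rv_Hsig[of 2] O_rv_not_Gsig[of 2] measurable_cong_sets[of Gsig Hsig] by auto
  with sets_Gsig_subset show ?thesis by auto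
qed

lemma sets_Hsig_psubset: "sets Hsig \<subset> sets Omega"
proof -
  have "sets Hsig \<noteq> sets Omega"
  proof
    assume eq: "sets Hsig = sets Omega"
    have "(\<lambda>w. Xs w 1 $ 1) \<in> borel_measurable Hsig"
      unfolding measurable_cong_sets[OF eq refl]
      by (intro borel_measurable_vec_nth Xs_Omega) simp
    then have "Xs (sample_point 1 0) 1 $ 1 = Xs (sample_point 1 (vector [1,0,0])) 1 $ 1"
      unfolding Hsig_def by (rule measurable_vimage_algebra_eq[OF _ angle_proj_space])
        (use pi_gt3 in \<open>auto intro!: sample_point_space proj_sample_point\<close>)
    then show False by (simp add: Xs_def sample_point_def)
  qed
  with sets_Hsig_subset show ?thesis by auto
qed

section \<open>Conditional expectations\<close>

locale kac_model =
  fixes b :: "real \<Rightarrow> real" and mu0 :: "(real^3) measure" and T :: "(nat \<Rightarrow> tree) measure" and t :: real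
  assumes beta: "prob_space (beta_law b)"
    and mu0: "prob_space mu0" "sets mu0 = sets borel"
    and T: "prob_space T" "sets T = sets TS"
    and t: "0 \<le> t"
begin

abbreviation P where "P \<equiv> Pt b mu0 T t"
abbreviation Be where "Be \<equiv> PiM {1::nat..} (\<lambda>_. beta_law b)"
abbreviation Th where "Th \<equiv> PiM {1::nat..} (\<lambda>_. unif)"
abbreviation XX where "XX \<equiv> PiM {1::nat..} (\<lambda>_. mu0)"

lemma sets_P [measurable_cong]: "sets P = sets Omega"
  unfolding Pt_def Omega_def
  by (intro sets_pair_measure_cong sets_PiM_cong refl sets_nu_law T sets_beta_law sets_unif mu0)

lemma space_P: "space P = space Omega"
  by (rule sets_eq_imp_space_eq[OF sets_P])

lemma probs: "prob_space (nu_law t)" "prob_space Be" "prob_space Th" "prob_space XX"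
  using t by (auto intro!: prob_space_nu_law prob_space_PiM beta prob_space_unif mu0)

sublocale P: prob_space P
  unfolding Pt_def by (intro prob_space_pair probs T)

sublocale XX: prob_space XX by (rule probs)
sublocale Th: prob_space Th by (rule probs)

lemma spaces:
  assumes "n \<in> space (nu_law t)" "s \<in> space T" "p \<in> space Be" "th \<in> space Th" "x \<in> space XX"
  shows "(n, s, p, th, x) \<in> space Omega"
  using assms unfolding space_P[symmetric] Pt_def by (simp add: space_pair_measure)

lemma integral_P:
  fixes f :: "omega \<Rightarrow> 'c::{banach, second_countable_topology}"
  assumes "f \<in> borel_measurable Omega" "\<And>w. norm (f w) \<le> C"
  shows "(\<integral>w. f w \<partial>P) = (\<integral>n. (\<integral>s. (\<integral>p. (\<integral>th. (\<integral>x. f (n, s, p, th, x) \<partial>XX) \<partial>Th) \<partial>Be) \<partial>T) \<partial>nu_law t)"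
  using assms(1) unfolding measurable_cong_sets[OF sets_P[symmetric] refl] unfolding Pt_def
  by (intro integral_pair5_bounded[where C=C] probs T assms(2))

lemma set_integral_Hsig_eq:
  fixes f g :: "omega \<Rightarrow> 'c::{banach, second_countable_topology}"
  assumes f: "f \<in> borel_measurable Omega" "\<And>w. norm (f w) \<le> C" and g: "g \<in> borel_measurable Omega" "\<And>w. norm (g w) \<le> C"
    and eq: "\<And>n s p th. n \<in> space (nu_law t) \<Longrightarrow> s \<in> space T \<Longrightarrow> p \<in> space Be \<Longrightarrow> th \<in> space Th \<Longrightarrow>
      (\<integral>x. f (n, s, p, th, x) \<partial>XX) = (\<integral>x. g (n, s, p, th, x) \<partial>XX)"
    and A: "A \<in> sets Hsig"
  shows "(LINT w:A|P. f w) = (LINT w:A|P. g w)"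
proof -
  have [measurable]: "A \<in> sets Omega" using A sets_Hsig_subset by auto
  obtain A' where A': "A = angle_proj -` A' \<inter> space Omega"
    using A unfolding Hsig_def sets_vimage_algebra2[OF angle_proj_space] by auto
  have C: "0 \<le> C" using f(2)[of undefined] norm_ge_zero order_trans by blast
  have *: "(LINT w:A|P. h w) = (\<integral>n. (\<integral>s. (\<integral>p. (\<integral>th. indicator A' (n, s, p, th) *\<^sub>R (\<integral>x. h (n, s, p, th, x) \<partial>XX) \<partial>Th) \<partial>Be) \<partial>T) \<partial>nu_law t)"
    if [measurable]: "h \<in> borel_measurable Omega" and h: "\<And>w. norm (h w) \<le> C" for h :: "omega \<Rightarrow> 'c"
  proof -
    have "(LINT w:A|P. h w) = (\<integral>n. (\<integral>s. (\<integral>p. (\<integral>th. (\<integral>x. indicator A (n, s, p, th, x) *\<^sub>R h (n, s, p, th, x) \<partial>XX) \<partial>Th) \<partial>Be) \<partial>T) \<partial>nu_law t)"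
      unfolding set_lebesgue_integral_def
      by (rule integral_P[where C=C]) (use h C in \<open>auto split: split_indicator\<close>)
    also have "\<dots> = (\<integral>n. (\<integral>s. (\<integral>p. (\<integral>th. (\<integral>x. indicator A' (n, s, p, th) *\<^sub>R h (n, s, p, th, x) \<partial>XX) \<partial>Th) \<partial>Be) \<partial>T) \<partial>nu_law t)"
      by (intro Bochner_Integration.integral_cong refl)
         (use spaces in \<open>auto simp: A' angle_proj_def indicator_def\<close>)
    finally show ?thesis by simp
  qed
  show ?thesis
    unfolding *[OF f] *[OF g] by (intro Bochner_Integration.integral_cong refl) (simp add: eq del: One_nat_def)
qed

lemma set_integral_Gsig_eq:
  fixes f g :: "omega \<Rightarrow> 'c::{banach, second_countable_topology}"
  assumes f: "f \<in> borel_measurable Omega" "\<And>w. norm (f w) \<le> C" and g: "g \<in> borel_measurable Omega" "\<And>w. norm (g w) \<le> C"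
    and eq: "\<And>n s p. n \<in> space (nu_law t) \<Longrightarrow> s \<in> space T \<Longrightarrow> p \<in> space Be \<Longrightarrow>
      (\<integral>th. (\<integral>x. f (n, s, p, th, x) \<partial>XX) \<partial>Th) = (\<integral>th. (\<integral>x. g (n, s, p, th, x) \<partial>XX) \<partial>Th)"
    and A: "A \<in> sets Gsig"
  shows "(LINT w:A|P. f w) = (LINT w:A|P. g w)"
proof -
  have [measurable]: "A \<in> sets Omega" using A sets_Hsig_subset sets_Gsig_subset by auto
  obtain A' where A': "A = hist_proj -` A' \<inter> space Omega"
    using A unfolding Gsig_def sets_vimage_algebra2[OF hist_proj_space] by auto
  have C: "0 \<le> C" using f(2)[of undefined] norm_ge_zero order_trans by blast
  have *: "(LINT w:A|P. h w) = (\<integral>n. (\<integral>s. (\<integral>p. indicator A' (n, s, p) *\<^sub>R (\<integral>th. (\<integral>x. h (n, s, p, th, x) \<partial>XX) \<partial>Th) \<partial>Be) \<partial>T) \<partial>nu_law t)"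
    if [measurable]: "h \<in> borel_measurable Omega" and h: "\<And>w. norm (h w) \<le> C" for h :: "omega \<Rightarrow> 'c"
  proof -
    have "(LINT w:A|P. h w) = (\<integral>n. (\<integral>s. (\<integral>p. (\<integral>th. (\<integral>x. indicator A (n, s, p, th, x) *\<^sub>R h (n, s, p, th, x) \<partial>XX) \<partial>Th) \<partial>Be) \<partial>T) \<partial>nu_law t)"
      unfolding set_lebesgue_integral_def
      by (rule integral_P[where C=C]) (use h C in \<open>auto split: split_indicator\<close>)
    also have "\<dots> = (\<integral>n. (\<integral>s. (\<integral>p. (\<integral>th. (\<integral>x. indicator A' (n, s, p) *\<^sub>R h (n, s, p, th, x) \<partial>XX) \<partial>Th) \<partial>Be) \<partial>T) \<partial>nu_law t)"
      by (intro Bochner_Integration.integral_cong refl)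
         (use spaces in \<open>auto simp: A' hist_proj_def indicator_def\<close>)
    finally show ?thesis by simp
  qed
  show ?thesis
    unfolding *[OF f] *[OF g] by (intro Bochner_Integration.integral_cong refl) (simp add: eq del: One_nat_def)
qed

lemma indep_Hsig_Xs: "P.indep_set (sets Hsig) (sets (vimage_algebra (space Omega) Xs (PiM {1..} (\<lambda>_. borel))))"
proof (rule P.indep_setI)
  have XsO: "Xs \<in> space Omega \<rightarrow> space (PiM {1..} (\<lambda>_. borel))"
    using measurable_space[OF Xs_Omega_PiM] by blast
  show "sets Hsig \<subseteq> P.events" using sets_Hsig_subset by (simp add: sets_P)
  show ev: "sets (vimage_algebra (space Omega) Xs (PiM {1..} (\<lambda>_. borel))) \<subseteq> P.events"
    unfolding sets_vimage_algebra2[OF XsO] sets_P using measurable_sets[OF Xs_Omega_PiM] by auto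
  fix a c assume a: "a \<in> sets Hsig" and c: "c \<in> sets (vimage_algebra (space Omega) Xs (PiM {1..} (\<lambda>_. borel)))"
  obtain c' where c': "c = Xs -` c' \<inter> space Omega" "c' \<in> sets (PiM {1..} (\<lambda>_. borel))"
    using c unfolding sets_vimage_algebra2[OF XsO] by auto
  have [measurable]: "c \<in> sets Omega" using c ev by (auto simp: sets_P)
  have key: "measure P (d \<inter> c) = measure XX c' * measure P d" if d: "d \<in> sets Hsig" for d
  proof -
    have [measurable]: "d \<in> sets Omega" using d sets_Hsig_subset by auto
    have "(LINT w:d|P. indicator c w :: real) = (LINT w:d|P. measure XX c')"
    proof (rule set_integral_Hsig_eq[where C=1, OF _ _ _ _ _ d])
      fix n s p th
      assume sp: "n \<in> space (nu_law t)" "s \<in> space T" "p \<in> space Be" "th \<in> space Th"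
      have "(\<integral>x. indicator c (n, s, p, th, x) \<partial>XX) = (\<integral>x. indicator c' x \<partial>XX)"
        using spaces[OF sp] by (intro Bochner_Integration.integral_cong refl) (auto simp: c' Xs_def indicator_def)
      also have "\<dots> = measure XX c'"
        using sets.sets_into_space[OF c'(2)] by (simp add: space_PiM sets_eq_imp_space_eq[OF mu0(2)] Int_absorb2)
      finally show "(\<integral>x. indicator c (n, s, p, th, x) \<partial>XX) = (\<integral>x. measure XX c' \<partial>XX)"
        by (simp add: XX.prob_space del: One_nat_def)
    qed (auto simp: indicator_def simp del: One_nat_def)
    moreover have "indicator d w *\<^sub>R (indicator c w :: real) = indicator (d \<inter> c) w" for w
      by (simp split: split_indicator)
    ultimately show ?thesis
      by (simp add: set_lebesgue_integral_def sets_P)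
  qed
  have "measure P c = measure XX c'"
    using key[of "space Omega"] sets.top[of Hsig] P.prob_space sets.sets_into_space[of c Omega] 
    by (simp add: Int_absorb1 flip: space_P)
  then show "measure P (a \<inter> c) = measure P a * measure P c"
    using key[OF a] by simp
qed

lemma S_rv_tree:
  assumes "w \<in> space Omega"
  shows "rho * S_rv B u w = (\<Sum>j\<in>{1..leaves (cur_tree w)}.
     ((rho * pistar (cur_tree w) (phis w) j) *\<^sub>R (B u *v (Ostar (cur_tree w) (phis w) (thetas w) j *v e3))) \<bullet> Xs w j)"
  using leaves_tau[OF assms nu_ge[OF assms]]
  by (simp add: S_rv_def cur_tree_def pi_rv_def psi_rv_def O_rv_def sum_distrib_left mult.assoc)

lemma iexp_S_rv_measurable: "(\<lambda>w. iexp (rho * S_rv B u w)) \<in> borel_measurable Omega"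
proof -
  have m: "(\<lambda>w. \<Sum>j\<in>{1..leaves r}. ((rho * pistar r (phis w) j) *\<^sub>R (B u *v (Ostar r (phis w) (thetas w) j *v e3))) \<bullet> Xs w j)
     \<in> borel_measurable Omega" for r
  proof (intro borel_measurable_sum borel_measurable_inner borel_measurable_scaleR borel_measurable_times
      borel_measurable_matrix_vector_mult measurable_const Xs_Omega)
    show "(\<lambda>w. pistar r (phis w) j) \<in> borel_measurable Omega" for j
      by (intro measurable_Hsig_Omega pistar_measurable phis_Hsig)
    show "(\<lambda>w. Ostar r (phis w) (thetas w) j) \<in> borel_measurable Omega" for j
      by (intro measurable_Hsig_Omega Ostar_measurable phis_Hsig thetas_Hsig) auto
  qed auto
  have "(\<lambda>w. rho * S_rv B u w) \<in> borel_measurable Omega"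
    by (subst measurable_cong[OF S_rv_tree], assumption)
       (rule measurable_compose_countable[OF m measurable_Hsig_Omega[OF measurable_Gsig_Hsig[OF cur_tree_Gsig]]])
  then show ?thesis by measurable
qed

lemma integral_XX_iexp_S_rv:
  assumes sp: "n \<in> space (nu_law t)" "s \<in> space T" "p \<in> space Be" "th \<in> space Th"
  shows "(\<integral>x. iexp (rho * S_rv B u (n, s, p, th, x)) \<partial>XX) = leaf_prod mu0 (s n) p rho (B u) th"
proof -
  define c where "c j = (rho * pistar (s n) p j) *\<^sub>R (B u *v (Ostar (s n) p th j *v e3))" for j
  have "(\<integral>x. iexp (rho * S_rv B u (n, s, p, th, x)) \<partial>XX) = (\<integral>x. (\<Prod>j\<in>{1..leaves (s n)}. iexp (c j \<bullet> x j)) \<partial>XX)"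
  proof (intro Bochner_Integration.integral_cong refl)
    fix x assume "x \<in> space XX"
    from S_rv_tree[OF spaces[OF sp this], of rho B u]
    have "rho * S_rv B u (n, s, p, th, x) = (\<Sum>j\<in>{1..leaves (s n)}. c j \<bullet> x j)"
      by (simp add: c_def cur_tree_def tau_def nu_def phis_def thetas_def Xs_def)
    then show "iexp (rho * S_rv B u (n, s, p, th, x)) = (\<Prod>j\<in>{1..leaves (s n)}. iexp (c j \<bullet> x j))"
      by (simp only: of_real_sum sum_distrib_left) (simp add: exp_sum)
  qed
  also have "\<dots> = (\<Prod>j\<in>{1..leaves (s n)}. \<integral>x. iexp (c j \<bullet> x) \<partial>mu0)"
    by (rule integral_PiM_prod[OF mu0(1)]) (auto simp: measurable_cong_sets[OF mu0(2) refl])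
  also have "\<dots> = leaf_prod mu0 (s n) p rho (B u) th"
    by (simp add: leaf_prod_def c_def ft_def)
  finally show ?thesis .
qed

lemma leaf_prod_Hsig:
  "(\<lambda>w. leaf_prod mu0 (cur_tree w) (phis w) rho R (thetas w)) \<in> borel_measurable Hsig"
  by (rule measurable_compose_countable[OF borel_measurable_leaf_prod[OF mu0] measurable_Gsig_Hsig[OF cur_tree_Gsig]])
     (auto intro: phis_Hsig thetas_Hsig)

lemma is_cond_exp_Hsig:
  "is_cond_exp P Hsig (\<lambda>w. iexp (rho * S_rv B u w)) (\<lambda>w. leaf_prod mu0 (cur_tree w) (phis w) rho (B u) (thetas w))"
  unfolding is_cond_exp_def
proof (intro conjI ballI)
  note m = leaf_prod_Hsig[of rho "B u"]
  note [measurable] = measurable_Hsig_Omega[OF m]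
  show "(\<lambda>w. leaf_prod mu0 (cur_tree w) (phis w) rho (B u) (thetas w)) \<in> borel_measurable Hsig" by (rule m)
  show "integrable P (\<lambda>w. leaf_prod mu0 (cur_tree w) (phis w) rho (B u) (thetas w))"
    by (intro P.integrable_const_bound[where B=1] AE_I2 norm_leaf_prod_le mu0) measurable
  fix A assume A: "A \<in> sets Hsig"
  show "(LINT w:A|P. leaf_prod mu0 (cur_tree w) (phis w) rho (B u) (thetas w)) = (LINT w:A|P. iexp (rho * S_rv B u w))"
  proof (rule set_integral_Hsig_eq[where C=1, OF _ norm_leaf_prod_le[OF mu0] iexp_S_rv_measurable _ _ A])
    fix n s p th
    assume sp: "n \<in> space (nu_law t)" "s \<in> space T" "p \<in> space Be" "th \<in> space Th"
    show "(\<integral>x. leaf_prod mu0 (cur_tree (n, s, p, th, x)) (phis (n, s, p, th, x)) rho (B u) (thetas (n, s, p, th, x)) \<partial>XX)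
       = (\<integral>x. iexp (rho * S_rv B u (n, s, p, th, x)) \<partial>XX)"
      unfolding integral_XX_iexp_S_rv[OF sp]
      by (simp add: cur_tree_def tau_def nu_def phis_def thetas_def XX.prob_space del: One_nat_def)
  qed (simp_all del: of_real_mult)
qed

lemma integral_Th_leaf_prod:
  assumes R: "orthogonal_matrix R"
  shows "(\<integral>th. leaf_prod mu0 r p rho R th \<partial>Th) = ft (Ctree r mu0 p) (rho *\<^sub>R column 3 R)"
proof -
  have coord: "(\<lambda>x. x i) \<in> borel_measurable (PiM K (\<lambda>_. unif))" if "i \<in> K" for i :: nat and K
    using measurable_compose[OF measurable_component_singleton[OF that] measurable_unif_id] .
  have m: "leaf_prod mu0 r p rho R \<in> borel_measurable (PiM {1..<leaves r} (\<lambda>_. unif))"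
    by (intro borel_measurable_leaf_prod mu0 coord) auto
  have "(\<integral>th. leaf_prod mu0 r p rho R th \<partial>Th) = (\<integral>th. leaf_prod mu0 r p rho R th \<partial>PiM {1..<leaves r} (\<lambda>_. unif))"
    by (rule integral_PiM_unif_reindex(1)[of "\<lambda>i. i", OF _ _ m]) (auto intro: leaf_prod_cong)
  also have "\<dots> = ft (Ctree r mu0 p) (rho *\<^sub>R (R *v e3))"
    by (rule integral_leaf_prod[OF mu0 R])
  also have "R *v e3 = column 3 R"
    by (simp add: e3_def matrix_vector_mult_columns3)
  finally show ?thesis .
qed

lemma is_cond_exp_Gsig:
  assumes "orthogonal_matrix (B u)" "column 3 (B u) = u"
  shows "is_cond_exp P Gsig (\<lambda>w. iexp (rho * S_rv B u w)) (\<lambda>w. ft (Mrand mu0 w) (rho *\<^sub>R u))"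
  unfolding is_cond_exp_def
proof (intro conjI ballI)
  show m: "(\<lambda>w. ft (Mrand mu0 w) (rho *\<^sub>R u)) \<in> borel_measurable Gsig"
    unfolding ft_def
    by (rule measurable_compose[OF measurable_prob_algebraD[OF Mrand_Gsig[OF mu0]] integral_measurable_subprob_algebra]) measurable
  note mO = measurable_Hsig_Omega[OF measurable_Gsig_Hsig[OF m]]
  note [measurable] = mO
  have bound: "norm (ft (Mrand mu0 w) (rho *\<^sub>R u)) \<le> 1" for w
    unfolding Mrand_def using prob_space_sets_Ctree[OF mu0] by (intro norm_ft_le) auto
  show "integrable P (\<lambda>w. ft (Mrand mu0 w) (rho *\<^sub>R u))"
    by (intro P.integrable_const_bound[where B=1] AE_I2 bound) measurable
  fix A assume A: "A \<in> sets Gsig"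
  show "(LINT w:A|P. ft (Mrand mu0 w) (rho *\<^sub>R u)) = (LINT w:A|P. iexp (rho * S_rv B u w))"
  proof (rule set_integral_Gsig_eq[where C=1, OF mO bound iexp_S_rv_measurable _ _ A])
    fix n s p
    assume sp: "n \<in> space (nu_law t)" "s \<in> space T" "p \<in> space Be"
    have "(\<integral>th. (\<integral>x. iexp (rho * S_rv B u (n, s, p, th, x)) \<partial>XX) \<partial>Th) = (\<integral>th. leaf_prod mu0 (s n) p rho (B u) th \<partial>Th)"
      by (intro Bochner_Integration.integral_cong refl integral_XX_iexp_S_rv sp)
    also have "\<dots> = ft (Ctree (s n) mu0 p) (rho *\<^sub>R u)"
      using integral_Th_leaf_prod[OF assms(1)] assms(2) by simp
    finally show "(\<integral>th. (\<integral>x. ft (Mrand mu0 (n, s, p, th, x)) (rho *\<^sub>R u) \<partial>XX) \<partial>Th)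
       = (\<integral>th. (\<integral>x. iexp (rho * S_rv B u (n, s, p, th, x)) \<partial>XX) \<partial>Th)"
      by (simp add: Mrand_def tau_def nu_def phis_def XX.prob_space Th.prob_space del: One_nat_def of_real_mult)
  qed (simp_all del: of_real_mult)
qed

end

lemma is_cond_exp_tower:
  assumes "is_cond_exp M G Z X" "is_cond_exp M H Z Y" "sets G \<subseteq> sets H"
  shows "is_cond_exp M G Y X"
  using assms unfolding is_cond_exp_def by auto

theorem theorem2:
  fixes b :: "real \<Rightarrow> real" and mu0 :: "(real^3) measure" and T :: "(nat \<Rightarrow> tree) measure"
  assumes b_meas: "b \<in> borel_measurable (restrict_space borel {-1<..<1})"
    and b_nonneg: "\<And>x. x \<in> {-1<..<1} \<Longrightarrow> b x \<ge> 0"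
    and b_sym: "\<And>x. x \<in> {-1<..<1} \<Longrightarrow> x \<noteq> 0 \<Longrightarrow>
                  b x = b (sqrt (1 - x\<^sup>2)) * \<bar>x\<bar> / sqrt (1 - x\<^sup>2) \<and> b x = b (- x)"
    and b_norm: "(\<integral>\<^sup>+ x\<in>{0<..<1}. ennreal (b x) \<partial>lborel) = 1"
    and mu0: "prob_space mu0" "sets mu0 = sets borel"
    and T: "tau_law T"
  shows "\<exists>G H :: omega measure.
     \<comment> \<open>(i)\<close>
     space G = space Omega \<and> space H = space Omega \<and> sets G \<subset> sets H \<and> sets H \<subset> sets Omega \<and>
     \<comment> \<open>(ii)\<close>
     Mrand mu0 \<in> measurable G (prob_algebra borel) \<and>
     nu \<in> measurable G (count_space UNIV) \<and>
     (\<forall>n\<ge>1. (\<lambda>w. \<lambda>j\<in>{1..n}. pi_rv j n w) \<in> measurable G (PiM {1..n} (\<lambda>_. borel))) \<and>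
     \<comment> \<open>(iii)\<close>
     (\<forall>n\<ge>1. (\<lambda>w. \<lambda>j\<in>{1..n}. O_rv j n w) \<in> measurable H (PiM {1..n} (\<lambda>_. borel))) \<and>
     (\<forall>n\<ge>2. (\<lambda>w. \<lambda>j\<in>{1..n}. O_rv j n w) \<notin> measurable G (PiM {1..n} (\<lambda>_. borel))) \<and>
     \<comment> \<open>(iv)\<close>
     (\<forall>t\<ge>0. prob_space.indep_set (Pt b mu0 T t) (sets H)
                 (sets (vimage_algebra (space Omega) Xs (PiM {1..} (\<lambda>_. borel))))) \<and>
     (\<forall>B. (\<forall>u. norm u = 1 \<longrightarrow> rotation_matrix (B u) \<and> column 3 (B u) = u) \<longrightarrow>
       (\<forall>t\<ge>0. \<forall>u. norm u = 1 \<longrightarrow>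
         \<comment> \<open>(v)\<close>
         (\<exists>Y :: real \<Rightarrow> omega \<Rightarrow> complex.
            (\<forall>rho. is_cond_exp (Pt b mu0 T t) H (\<lambda>w. iexp (rho * S_rv B u w)) (Y rho)) \<and>
            (\<forall>w. \<exists>(Q :: (nat \<Rightarrow> real) measure) (N :: nat) (Z :: nat \<Rightarrow> (nat \<Rightarrow> real) \<Rightarrow> real).
                 prob_space Q \<and> prob_space.indep_vars Q (\<lambda>_. borel) Z {..<N} \<and>
                 (\<forall>rho. Y rho w = char (distr Q borel (\<lambda>x. \<Sum>k<N. Z k x)) rho)))) \<and>
         \<comment> \<open>(vi)\<close>
         (\<forall>t\<ge>0. \<forall>xi :: real^3. xi \<noteq> 0 \<longrightarrow>
            is_cond_exp (Pt b mu0 T t) G (\<lambda>w. iexp (norm xi * S_rv B (xi /\<^sub>R norm xi) w))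
                        (\<lambda>w. ft (Mrand mu0 w) xi) \<and>
            (\<forall>Y. is_cond_exp (Pt b mu0 T t) H (\<lambda>w. iexp (norm xi * S_rv B (xi /\<^sub>R norm xi) w)) Y \<longrightarrow>
                 is_cond_exp (Pt b mu0 T t) G Y (\<lambda>w. ft (Mrand mu0 w) xi))))"
proof -
  have model: "kac_model b mu0 T t" if "0 \<le> t" for t
  proof (rule kac_model.intro)
    show "prob_space (beta_law b)"
      by (rule prob_space_beta_law[OF b_meas b_nonneg _ b_norm]) (use b_sym in blast)+
    show "prob_space T" "sets T = sets TS" using T by (auto simp: tau_law_def)
  qed (fact mu0 that)+
  have G: "is_cond_exp (Pt b mu0 T t) Gsig (\<lambda>w. iexp (norm xi * S_rv B (xi /\<^sub>R norm xi) w)) (\<lambda>w. ft (Mrand mu0 w) xi)"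
    if "0 \<le> t" "xi \<noteq> 0" "\<forall>u. norm u = 1 \<longrightarrow> rotation_matrix (B u) \<and> column 3 (B u) = u" for t B and xi :: "real^3"
  proof -
    have "norm (xi /\<^sub>R norm xi) = 1" using that(2) by simp
    with that(3) have "orthogonal_matrix (B (xi /\<^sub>R norm xi))" "column 3 (B (xi /\<^sub>R norm xi)) = xi /\<^sub>R norm xi"
      by (auto simp: rotation_matrix_def)
    from kac_model.is_cond_exp_Gsig[where B=B and u="xi /\<^sub>R norm xi" and rho="norm xi", OF model[OF that(1)] this] that(2)
    show ?thesis by simp
  qed
  have Y: "\<exists>Y :: real \<Rightarrow> omega \<Rightarrow> complex.
      (\<forall>rho. is_cond_exp (Pt b mu0 T t) Hsig (\<lambda>w. iexp (rho * S_rv B u w)) (Y rho)) \<and>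
      (\<forall>w. \<exists>(Q :: (nat \<Rightarrow> real) measure) (N :: nat) (Z :: nat \<Rightarrow> (nat \<Rightarrow> real) \<Rightarrow> real).
         prob_space Q \<and> prob_space.indep_vars Q (\<lambda>_. borel) Z {..<N} \<and>
         (\<forall>rho. Y rho w = char (distr Q borel (\<lambda>x. \<Sum>k<N. Z k x)) rho))" if "0 \<le> t" for t B u
    by (rule exI[of _ "\<lambda>rho w. leaf_prod mu0 (cur_tree w) (phis w) rho (B u) (thetas w)"])
       (intro conjI allI kac_model.is_cond_exp_Hsig model that leaf_prod_char_sum mu0)
  show ?thesis
    by (rule exI[of _ Gsig], rule exI[of _ Hsig], intro conjI allI impI space_Gsig space_Hsig sets_Gsig_psubset sets_Hsig_psubset
        Mrand_Gsig mu0 nu_Gsig_UNIV pi_rv_Gsig O_rv_Hsig O_rv_not_Gsig kac_model.indep_Hsig_Xs model Y)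
       (assumption | rule G | rule is_cond_exp_tower[OF G _ sets_Gsig_subset])+
qed

end
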